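(* If there are two minimal admissible $\mathrm{Cl}_{r,s}$-modules $V^{r,s}_+$ and $V^{r,s}_-$, then the Lie algebras $\mathcal N_{r,s}(V^{r,s}_+)$ and $\mathcal N_{r,s}(V^{r,s}_-)$ are isomorphic.
   Context: $\mathbb R^{r,s}$ denotes $\mathbb R^{r+s}$ with the symmetric bilinear form $\langle x,y\rangle_{r,s}=\sum_{i=1}^r x_iy_i-\sum_{j=1}^s x_{r+j}y_{r+j}$, and $\mathrm{Cl}_{r,s}$ is the Clifford algebra it generates with the convention $x\otimes x=-\langle x,x\rangle_{r,s}$. A $\mathrm{Cl}_{r,s}$-module is a finite-dimensional real vector space $U$ with a linear map $J\colon\mathbb R^{r,s}\to\mathrm{End}(U)$ such that $J_z^2=-\langle z,z\rangle_{r,s}\mathrm{Id}_U$. It is admissible if equipped with a non-degenerate symmetric bilinear form $\langle\cdot,\cdot\rangle_U$ with $\langle J_zx,y\rangle_U+\langle x,J_zy\rangle_U=0$ for all $z,x,y$; minimal admissible means (nonzero) admissible of the smallest possible dimension. $\mathcal N_{r,s}(U)=U\oplus\mathbb R^{r,s}$ is the 2-step nilpotent Lie algebra with centre $\mathbb R^{r,s}$ and bracket $[U,U]\subset\mathbb R^{r,s}$ given by $\langle J_zx,y\rangle_U=\langle z,[x,y]\rangle_{r,s}$. When $r-s\equiv 3\pmod 4$ there are two non-equivalent irreducible modules $V_+$, $V_-$, on which the volume form $\Omega^{r,s}=\prod_{j=1}^{r+s}J_{z_j}$ ($\{z_j\}$ an orthonormal basis of $\mathbb R^{r,s}$) acts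 as $+\mathrm{Id}$ and $-\mathrm{Id}$ respectively. If moreover $s$ is even there are two minimal admissible modules $V^{r,s}_{\pm}$, based on $V_\pm$ (equal to $V_\pm$ or to $V_\pm\oplus V_\pm$), so that $\Omega^{r,s}$ acts on $V^{r,s}_\pm$ as $\pm\mathrm{Id}$. *)

theory Defs
  imports "HOL-Analysis.Analysis" "HOL-Number_Theory.Cong"
begin

text \<open>
  The space \<open>\<real>\<^sup>r\<^sup>,\<^sup>s\<close> is the type \<open>real ^ 'n\<close> with \<open>CARD('n) = r + s\<close>; the equation is stated
  where it is used, so that \<open>r = 0\<close> and \<open>s = 0\<close> are allowed (type indices cannot be empty, which
  rules out a product of two vector types). The linear order on \<open>'n\<close> numbers the coordinates.
  Positions are counted from 0.
\<close>

definition coord_pos :: "'n::{finite,linorder} \<Rightarrow> nat" where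
  "coord_pos i = card {..<i}"

definition rs_form :: "nat \<Rightarrow> nat \<Rightarrow> real ^ 'n::{finite,linorder} \<Rightarrow> (real, 'n) vec \<Rightarrow> real" where
  "rs_form r s x y =
     (\<Sum>i | coord_pos i < r. x $ i * y $ i)
     - (\<Sum>i | r \<le> coord_pos i \<and> coord_pos i < r + s. x $ i * y $ i)"

definition rs_orthonormal_basis ::
    "nat \<Rightarrow> nat \<Rightarrow> (nat \<Rightarrow> real ^ 'n::{finite,linorder}) \<Rightarrow> bool" where
  "rs_orthonormal_basis r s z \<longleftrightarrow>
     (\<forall>i\<in>{1..r+s}. \<bar>rs_form r s (z i) (z i)\<bar> = 1) \<and>
     (\<forall>i\<in>{1..r+s}. \<forall>j\<in>{1..r+s}. i \<noteq> j \<longrightarrow> rs_form r s (z i) (z j) = 0) \<and>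
     span (z ` {1..r+s}) = UNIV"

text \<open>
  Modules live on a linear subspace \<open>U\<close> of an ambient real vector space, because minimality has to
  compare modules of different dimensions. Values outside the subspace are irrelevant.
\<close>

definition finite_dim_subspace :: "'a::real_vector set \<Rightarrow> bool" where
  "finite_dim_subspace U \<longleftrightarrow> (\<exists>b. finite b \<and> span b = U)"

definition linear_on_subspace ::
    "'a::real_vector set \<Rightarrow> ('a \<Rightarrow> 'b::real_vector) \<Rightarrow> bool" where
  "linear_on_subspace U f \<longleftrightarrow>
     (\<forall>x\<in>U. \<forall>y\<in>U. f (x + y) = f x + f y) \<and> (\<forall>c. \<forall>x\<in>U. f (c *\<^sub>R x) = c *\<^sub>R f x)"

definition clifford_module ::
    "nat \<Rightarrow> nat \<Rightarrow> 'u::real_vector set \<Rightarrow> (real ^ 'n::{finite,linorder} \<Rightarrow> 'u \<Rightarrow> 'u) \<Rightarrow> bool" where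
  "clifford_module r s U J \<longleftrightarrow>
     finite_dim_subspace U \<and>
     (\<forall>z. linear_on_subspace U (J z) \<and> J z ` U \<subseteq> U) \<and>
     (\<forall>x\<in>U. linear (\<lambda>z. J z x)) \<and>
     (\<forall>z. \<forall>x\<in>U. J z (J z x) = - rs_form r s z z *\<^sub>R x)"

definition nondegenerate_symmetric_form ::
    "'u::real_vector set \<Rightarrow> ('u \<Rightarrow> 'u \<Rightarrow> real) \<Rightarrow> bool" where
  "nondegenerate_symmetric_form U B \<longleftrightarrow>
     (\<forall>x\<in>U. linear_on_subspace U (B x)) \<and>
     (\<forall>x\<in>U. \<forall>y\<in>U. B x y = B y x) \<and>
     (\<forall>x\<in>U. (\<forall>y\<in>U. B x y = 0) \<longrightarrow> x = 0)"

definition admissible_module ::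
    "nat \<Rightarrow> nat \<Rightarrow> 'u::real_vector set \<Rightarrow> (real ^ 'n::{finite,linorder} \<Rightarrow> 'u \<Rightarrow> 'u)
      \<Rightarrow> ('u \<Rightarrow> 'u \<Rightarrow> real) \<Rightarrow> bool" where
  "admissible_module r s U J B \<longleftrightarrow>
     clifford_module r s U J \<and>
     nondegenerate_symmetric_form U B \<and>
     (\<forall>z. \<forall>x\<in>U. \<forall>y\<in>U. B (J z x) y + B x (J z y) = 0)"

text \<open>
  It suffices to compare with modules carried by subspaces \<open>W\<close> of the same ambient type: a module
  of dimension smaller than \<open>dim U\<close>, on whatever space, can be transported to a subspace of \<open>U\<close>.
\<close>

definition minimal_admissible_module ::
    "nat \<Rightarrow> nat \<Rightarrow> 'u::real_vector set \<Rightarrow> (real ^ 'n::{finite,linorder} \<Rightarrow> 'u \<Rightarrow> 'u)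
      \<Rightarrow> ('u \<Rightarrow> 'u \<Rightarrow> real) \<Rightarrow> bool" where
  "minimal_admissible_module r s U J B \<longleftrightarrow>
     admissible_module r s U J B \<and> U \<noteq> {0} \<and>
     (\<forall>(W :: 'u set) (J' :: (real, 'n) vec \<Rightarrow> 'u \<Rightarrow> 'u) B'.
        admissible_module r s W J' B' \<and> W \<noteq> {0} \<longrightarrow> dim U \<le> dim W)"

text \<open>The operator \<open>J (z 1) \<circ> \<dots> \<circ> J (z m)\<close>.\<close>

definition volume_form :: "nat \<Rightarrow> (nat \<Rightarrow> 'z) \<Rightarrow> ('z \<Rightarrow> 'u \<Rightarrow> 'u) \<Rightarrow> 'u \<Rightarrow> 'u" where
  "volume_form m z J = foldr (\<lambda>j f. J (z j) \<circ> f) [1..<Suc m] id"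

definition module_bracket ::
    "nat \<Rightarrow> nat \<Rightarrow> (real ^ 'n::{finite,linorder} \<Rightarrow> 'u \<Rightarrow> 'u) \<Rightarrow> ('u \<Rightarrow> 'u \<Rightarrow> real)
      \<Rightarrow> 'u \<Rightarrow> 'u \<Rightarrow> (real, 'n) vec" where
  "module_bracket r s J B x y = (THE w. \<forall>z. B (J z x) y = rs_form r s z w)"

definition N_carrier :: "'u set \<Rightarrow> ('u \<times> (real, 'n) vec) set" where
  "N_carrier U = U \<times> UNIV"

definition N_bracket ::
    "nat \<Rightarrow> nat \<Rightarrow> (real ^ 'n::{finite,linorder} \<Rightarrow> 'u \<Rightarrow> 'u) \<Rightarrow> ('u \<Rightarrow> 'u \<Rightarrow> real)
      \<Rightarrow> 'u::zero \<times> (real, 'n) vec \<Rightarrow> 'u \<times> (real, 'n) vec \<Rightarrow> 'u \<times> (real, 'n) vec" where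
  "N_bracket r s J B p q = (0, module_bracket r s J B (fst p) (fst q))"

definition lie_algebras_isomorphic ::
    "'a::real_vector set \<Rightarrow> ('a \<Rightarrow> 'a \<Rightarrow> 'a) \<Rightarrow> 'b::real_vector set \<Rightarrow> ('b \<Rightarrow> 'b \<Rightarrow> 'b) \<Rightarrow> bool" where
  "lie_algebras_isomorphic L br L' br' \<longleftrightarrow>
     (\<exists>\<phi>. bij_betw \<phi> L L' \<and> linear_on_subspace L \<phi> \<and>
          (\<forall>p\<in>L. \<forall>q\<in>L. \<phi> (br p q) = br' (\<phi> p) (\<phi> q)))"

end

theory Submission
  imports Defs "HOL-Computational_Algebra.Fundamental_Theorem_Algebra"
begin

text \<open>
  Since \<open>r + s\<close> is odd, replacing \<open>J'\<close> by \<open>-J'\<close> changes the sign of the volume form, and the sign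
  change can be absorbed by the centre. So it suffices to find a linear isomorphism \<open>P\<close> between
  two minimal admissible modules with the same volume form that intertwines the Clifford actions and
  satisfies \<open>B' (P x) (P y) = c B x y\<close> with \<open>c \<noteq> 0\<close>; the factor \<open>c\<close> again goes into the centre.

  Splitting a map of rank one successively into eigenvectors of the involutions
  \<open>T \<mapsto> \<plusminus> J'\<^sub>i T J\<^sub>i\<close>, which are isometries for the trace form, gives \<open>T\<close> with \<open>T\<^sup>* T \<noteq> 0\<close> that
  commutes with each \<open>J\<^sub>i\<close> up to a sign. Equality of the volume forms makes the number of minus signs
  even, and then the product of the corresponding \<open>J\<^sub>i\<close> corrects them all.

  By minimality a self-adjoint endomorphism of the module is zero or injective, since otherwise its
  image would be a smaller admissible module. Hence \<open>S = T\<^sup>* T\<close> generates a field isomorphic to \<open>\<real>\<close>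
  or \<open>\<complex>\<close>, and composing \<open>T\<close> with a suitable element of that field makes \<open>T\<^sup>* T\<close> a real scalar.
\<close>

section \<open>Linear maps on finite-dimensional subspaces\<close>

lemma finite_dim_subspaceE:
  assumes "finite_dim_subspace U"
  obtains E where "finite E" "independent E" "span E = U" "E \<subseteq> U"
proof -
  obtain b where b: "finite b" "span b = U"
    using assms unfolding finite_dim_subspace_def by blast
  obtain E where E: "E \<subseteq> b" "independent E" "b \<subseteq> span E"
    using maximal_independent_subset[of b] by blast
  have "span E = U"
    using E(1,3) b(2) by (metis span_mono span_span subset_antisym)
  then show ?thesis
    using that[of E] E b span_superset[of E] finite_subset by blast
qed

lemma finite_dim_subspace_imp_subspace: "finite_dim_subspace U \<Longrightarrow> subspace U"
  unfolding finite_dim_subspace_def using subspace_span by blast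

lemma linear_on_subspace_add:
  "linear_on_subspace U f \<Longrightarrow> x \<in> U \<Longrightarrow> y \<in> U \<Longrightarrow> f (x + y) = f x + f y"
  and linear_on_subspace_scale:
  "linear_on_subspace U f \<Longrightarrow> x \<in> U \<Longrightarrow> f (c *\<^sub>R x) = c *\<^sub>R f x"
  unfolding linear_on_subspace_def by blast+

lemma linear_on_subspace_neg:
  "linear_on_subspace U f \<Longrightarrow> x \<in> U \<Longrightarrow> f (- x) = - f x"
  using linear_on_subspace_scale[of U f x "-1"] by simp

lemma linear_on_subspace_zero:
  "linear_on_subspace U f \<Longrightarrow> subspace U \<Longrightarrow> f 0 = 0"
  using linear_on_subspace_scale[of U f 0 0] by (simp add: subspace_0)

lemma linear_on_subspace_sum:
  assumes "linear_on_subspace U f" "subspace U" "\<And>i. i \<in> I \<Longrightarrow> g i \<in> U"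
  shows "f (\<Sum>i\<in>I. g i) = (\<Sum>i\<in>I. f (g i))"
  using assms(3)
proof (induction I rule: infinite_finite_induct)
  case (insert i I)
  then have "f (g i + (\<Sum>i\<in>I. g i)) = f (g i) + f (\<Sum>i\<in>I. g i)"
    by (intro linear_on_subspace_add[OF assms(1)]) (auto intro!: subspace_sum assms(2))
  with insert show ?case by simp
qed (use assms linear_on_subspace_zero in auto)

lemma linear_on_subspace_subset:
  "linear_on_subspace V f \<Longrightarrow> U \<subseteq> V \<Longrightarrow> linear_on_subspace U f"
  by (simp add: linear_on_subspace_def subset_iff)

lemma linear_on_subspace_compose:
  assumes "linear_on_subspace U f" "linear_on_subspace V g" "\<And>x. x \<in> U \<Longrightarrow> f x \<in> V"
  shows "linear_on_subspace U (\<lambda>x. g (f x))"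
  using assms unfolding linear_on_subspace_def by simp

text \<open>Maps on a module are constrained only on \<open>U\<close>. Extending them from a basis
  of \<open>U\<close> gives globally linear maps, to which facts about spans, images and injectivity
  apply.\<close>

lemma linear_on_subspace_extend:
  assumes "linear_on_subspace U f" "finite_dim_subspace U"
  obtains g where "linear g" "\<And>x. x \<in> U \<Longrightarrow> g x = f x"
proof -
  obtain E where E: "finite E" "independent E" "span E = U" "E \<subseteq> U"
    using finite_dim_subspaceE[OF assms(2)] .
  obtain g where g: "linear g" "\<forall>x\<in>E. g x = f x"
    using linear_independent_extend[OF E(2), of f] by blast
  have "subspace U" using assms(2) finite_dim_subspace_imp_subspace by blast
  have "g x = f x" if "x \<in> U" for x
  proof -
    obtain c where "x = (\<Sum>e\<in>E. c e *\<^sub>R e)"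
      using \<open>x \<in> U\<close> E span_finite[of E] by auto
    moreover have "f (\<Sum>e\<in>E. c e *\<^sub>R e) = (\<Sum>e\<in>E. c e *\<^sub>R f e)"
      using linear_on_subspace_sum[OF assms(1) \<open>subspace U\<close>, of E "\<lambda>e. c e *\<^sub>R e"]
        linear_on_subspace_scale[OF assms(1)] E(4) \<open>subspace U\<close>
      by (smt (verit, best) subset_iff subspace_scale sum.cong)
    moreover have "g (\<Sum>e\<in>E. c e *\<^sub>R e) = (\<Sum>e\<in>E. c e *\<^sub>R f e)"
      using g by (simp add: linear_sum linear_scale)
    ultimately show ?thesis by simp
  qed
  then show ?thesis using that g(1) by blast
qed

text \<open>A basis of the image can be chosen inside the image of a basis \<open>E\<close> of
  \<open>U\<close>. The dimension bound leaves no room for a collapse, so \<open>f\<close> is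
  injective on \<open>E\<close> with independent image.\<close>

lemma linear_dim_image_inj:
  assumes "linear f" "finite_dim_subspace U" "dim U \<le> dim (f ` U)"
  shows "inj_on f U"
proof -
  obtain E where E: "finite E" "independent E" "span E = U" "E \<subseteq> U"
    using finite_dim_subspaceE[OF assms(2)] .
  have fU: "f ` U = span (f ` E)"
    using linear_span_image[OF assms(1), of E] E(3) by simp
  obtain F where F: "F \<subseteq> f ` E" "independent F" "f ` E \<subseteq> span F"
    using maximal_independent_subset[of "f ` E"] by blast
  have "dim (f ` U) = card F"
    using F by (metis dim_eq_card fU span_mono span_span subset_antisym)
  moreover have "dim U = card E" using E by (metis dim_eq_card span_span)
  ultimately have "card E \<le> card F" using assms(3) by simp
  moreover have "card F \<le> card (f ` E)" "card (f ` E) \<le> card E"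
    using F(1) E(1) by (auto simp: card_mono card_image_le)
  ultimately have "card F = card (f ` E)" "card (f ` E) = card E" by linarith+
  then have "F = f ` E" "inj_on f E"
    using F(1) E(1) by (auto simp: card_subset_eq eq_card_imp_inj_on)
  then show ?thesis
    using linear_inj_on_span_iff_independent_image[OF assms(1), of E] F(2) E(3) by simp
qed

text \<open>The ambient space may be infinite-dimensional, so the argument goes through bases: a
  basis \<open>F\<close> of \<open>V\<close> is as large as the basis \<open>E\<close> of
  \<open>U\<close>, and an element of \<open>E\<close> outside \<open>span F\<close> would extend it
  beyond the exchange bound.\<close>

lemma subspace_dim_eqI:
  assumes "subspace V" "V \<subseteq> U" "finite_dim_subspace U" "dim U \<le> dim V"
  shows "V = U"
proof -
  obtain E where E: "finite E" "independent E" "span E = U" "E \<subseteq> U"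
    using finite_dim_subspaceE[OF assms(3)] .
  obtain F where F: "F \<subseteq> V" "independent F" "V \<subseteq> span F" "card F = dim V"
    using basis_exists[of V] by blast
  have "F \<subseteq> span E" using F assms E by blast
  then have "finite F" "card F \<le> card E"
    using independent_span_bound[OF E(1) F(2)] by auto
  moreover have "card E = dim U" using E by (metis dim_eq_card span_span)
  ultimately have c: "card F = card E" using assms(4) F(4) by linarith
  have "e \<in> span F" if "e \<in> E" for e
  proof (rule ccontr)
    assume e: "e \<notin> span F"
    then have "independent (insert e F)" using F(2) by (rule independent_insertI)
    moreover have "insert e F \<subseteq> span E" using \<open>F \<subseteq> span E\<close> that span_base by blast
    ultimately have "card (insert e F) \<le> card E" using independent_span_bound[OF E(1)] by blast
    moreover have "e \<notin> F" using e span_base by blast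
    ultimately show False using c \<open>finite F\<close> by simp
  qed
  then have "U \<subseteq> span F" using E(3) by (metis span_mono span_span subsetI)
  moreover have "span F \<subseteq> V" using F(1) assms(1) by (metis span_minimal)
  ultimately show ?thesis using assms(2) by blast
qed

lemma inj_on_subspace_surj:
  assumes "linear f" "finite_dim_subspace U" "inj_on f U" "f ` U \<subseteq> U"
  shows "f ` U = U"
proof -
  obtain E where E: "finite E" "independent E" "span E = U" "E \<subseteq> U"
    using finite_dim_subspaceE[OF assms(2)] .
  have "independent (f ` E)"
    using linear_independent_injective_image[OF assms(1), of E] assms(3) E by simp
  moreover have "f ` U = span (f ` E)"
    using linear_span_image[OF assms(1), of E] E(3) by simp
  ultimately have "dim (f ` U) = card (f ` E)"
    by (metis dim_span_eq_card_independent)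
  also have "\<dots> = card E" using assms(3) E(4) card_image inj_on_subset by blast
  also have "\<dots> = dim U" using E by (metis dim_eq_card span_span)
  finally show ?thesis
    using subspace_dim_eqI[of "f ` U" U] assms
      linear_subspace_image[OF assms(1) finite_dim_subspace_imp_subspace[OF assms(2)]] by simp
qed

section \<open>Polynomials in an operator\<close>

text \<open>This is \<open>p(S) x\<close>, computed by Horner's scheme.\<close>

definition poly_map :: "('a::real_vector \<Rightarrow> 'a) \<Rightarrow> real poly \<Rightarrow> 'a \<Rightarrow> 'a" where
  "poly_map S p x = fold_coeffs (\<lambda>a y. a *\<^sub>R x + S y) p 0"

lemma poly_map_0 [simp]: "poly_map S 0 x = 0"
  by (simp add: poly_map_def)

context
  fixes S :: "'a::real_vector \<Rightarrow> 'a"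
  assumes S: "linear S"
begin

lemma poly_map_pCons: "poly_map S (pCons a p) x = a *\<^sub>R x + S (poly_map S p x)"
  by (cases "p = 0 \<and> a = 0")
    (auto simp: poly_map_def linear_0[OF S])

lemma poly_map_add: "poly_map S (p + q) x = poly_map S p x + poly_map S q x"
  by (induction p q rule: poly_induct2)
    (simp_all add: poly_map_pCons linear_add[OF S] scaleR_left_distrib)

lemma poly_map_smult: "poly_map S (smult c p) x = c *\<^sub>R poly_map S p x"
  by (induction p) (simp_all add: poly_map_pCons linear_scale[OF S] scaleR_right_distrib)

lemma poly_map_mult: "poly_map S (p * q) x = poly_map S p (poly_map S q x)"
  by (induction p) (simp_all add: poly_map_pCons poly_map_add poly_map_smult)

lemma poly_map_at_0: "poly_map S p 0 = 0"
  by (induction p) (simp_all add: poly_map_pCons linear_0[OF S])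

lemma poly_map_monom: "poly_map S (monom c n) x = c *\<^sub>R (S ^^ n) x"
  by (induction n) (simp_all add: monom_0 monom_Suc poly_map_pCons linear_0[OF S] linear_scale[OF S])

lemma poly_map_sum: "poly_map S (\<Sum>i\<in>I. p i) x = (\<Sum>i\<in>I. poly_map S (p i) x)"
  by (induction I rule: infinite_finite_induct) (simp_all add: poly_map_add)

text \<open>The iterates of \<open>x\<close> under \<open>S\<close> stay in the finite-dimensional
  \<open>U\<close>, so they satisfy a linear relation, whose coefficients form
  \<open>p\<close>.\<close>

lemma poly_map_annihilates:
  assumes "finite_dim_subspace U" "S ` U \<subseteq> U" "x \<in> U"
  shows "\<exists>p. p \<noteq> 0 \<and> poly_map S p x = 0"
proof -
  have inU: "(S ^^ i) x \<in> U" for i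
    using assms by (induction i) auto
  show ?thesis
  \<comment> \<open>Dependence is a property of sets and does not see a repeated iterate, so
    coinciding iterates are treated separately; they give a difference of two monomials.\<close>
  proof (cases "inj (\<lambda>i. (S ^^ i) x)")
    case False
    then obtain i j where ij: "i \<noteq> j" "(S ^^ i) x = (S ^^ j) x"
      unfolding inj_def by blast
    have "monom (1::real) i \<noteq> monom 1 j"
      using ij(1) by (metis monom_eq_iff' zero_neq_one)
    moreover have "poly_map S (monom 1 i + smult (-1) (monom 1 j)) x = 0"
      using ij by (simp only: poly_map_add poly_map_smult poly_map_monom) simp
    ultimately show ?thesis
      by (intro exI[of _ "monom 1 i + smult (-1) (monom 1 j)"]) (simp add: add_eq_0_iff)
  next
    case True
    define R where "R = range (\<lambda>i. (S ^^ i) x)"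
    have "infinite R" using True unfolding R_def by (rule range_inj_infinite)
    moreover obtain E where E: "finite E" "independent E" "span E = U" "E \<subseteq> U"
      using finite_dim_subspaceE[OF assms(1)] .
    moreover have "R \<subseteq> U" using inU unfolding R_def by blast
    ultimately have "dependent R" using independent_span_bound[OF E(1), of R] by blast
    then obtain t u where t: "finite t" "t \<subseteq> R" "(\<Sum>v\<in>t. u v *\<^sub>R v) = 0" "\<exists>v\<in>t. u v \<noteq> 0"
      unfolding dependent_explicit by blast
    \<comment> \<open>\<open>k\<close> recovers the exponent of an iterate, which turns a relation
      among vectors into a polynomial.\<close>
    define k where "k = inv (\<lambda>i. (S ^^ i) x)"
    have k: "(S ^^ k v) x = v" if "v \<in> t" for v
      using that t(2) f_inv_into_f[of v "\<lambda>i. (S ^^ i) x" UNIV] unfolding R_def k_def by blast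
    define p where "p = (\<Sum>v\<in>t. monom (u v) (k v))"
    have "poly_map S p x = (\<Sum>v\<in>t. u v *\<^sub>R v)"
      unfolding p_def poly_map_sum by (intro sum.cong) (simp_all add: poly_map_monom k)
    moreover have "p \<noteq> 0"
    proof -
      obtain v where v: "v \<in> t" "u v \<noteq> 0" using t(4) by blast
      \<comment> \<open>Distinct vectors have distinct exponents, so only the term of
        \<open>v\<close> contributes to this coefficient.\<close>
      have "coeff p (k v) = (\<Sum>w\<in>t. if w = v then u w else 0)"
        unfolding p_def coeff_sum
      proof (intro sum.cong)
        fix w assume "w \<in> t"
        then have "k w = k v \<longleftrightarrow> w = v" using k v(1) by metis
        then show "coeff (monom (u w) (k w)) (k v) = (if w = v then u w else 0)" by auto
      qed simp
      then show ?thesis using v t(1) by auto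
    qed
    ultimately show ?thesis using t(3) by auto
  qed
qed

end

text \<open>Evaluation at a complex number is the same calculus for the operator
  \<open>w \<mapsto> \<mu> * w\<close>, applied to 1. This lets a real polynomial be divided with
  remainder before it is evaluated at \<open>\<mu>\<close>.\<close>

lemma poly_map_complex:
  "poly_map (\<lambda>w. \<mu> * w) p 1 = poly (map_poly complex_of_real p) \<mu>"
proof -
  have "linear (\<lambda>w::complex. \<mu> * w)"
    by (simp add: bounded_linear.linear bounded_linear_mult_right)
  then show ?thesis
    by (induction p) (simp_all add: map_poly_pCons poly_map_pCons scaleR_conv_of_real)
qed

text \<open>A complex root of \<open>p\<close> supplies a real factor \<open>l\<close> of degree one
  or two. Either \<open>l\<close> already annihilates \<open>x\<close>, or its value at
  \<open>x\<close> is a nonzero vector annihilated by the cofactor of smaller degree, and induction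
  applies.\<close>

lemma real_quadratic_factor_kernel:
  fixes S :: "'a::real_vector \<Rightarrow> 'a"
  assumes S: "linear S" "subspace U" "S ` U \<subseteq> U"
    and "p \<noteq> 0" "poly_map S p x = 0" "x \<noteq> 0" "x \<in> U"
  shows "\<exists>y\<in>U. y \<noteq> 0 \<and> ((\<exists>a. S y = a *\<^sub>R y) \<or>
           (\<exists>a b. b \<noteq> 0 \<and> S (S y) = (2 * a) *\<^sub>R S y - (a\<^sup>2 + b\<^sup>2) *\<^sub>R y))"
  using assms(4-)
proof (induction "degree p" arbitrary: p x rule: less_induct)
  case less
  have in_U: "poly_map S q y \<in> U" if "y \<in> U" for q y
    using that S
    by (induction q)
      (auto simp: poly_map_pCons subspace_0 image_subset_iff intro!: subspace_add subspace_scale)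
  have factor: ?case
    if l: "l dvd p" "degree l > 0"
      and ker: "\<And>y. y \<in> U \<Longrightarrow> y \<noteq> 0 \<Longrightarrow> poly_map S l y = 0 \<Longrightarrow> ?case" for l
  proof (cases "poly_map S l x = 0")
    case True
    then show ?thesis using ker less.prems by blast
  next
    case False
    obtain q where q: "p = q * l" using l(1) by (metis dvd_def mult.commute)
    then have "q \<noteq> 0" "l \<noteq> 0" using less.prems(1) by auto
    then have "degree q < degree p" using l(2) by (simp add: q degree_mult_eq)
    moreover have "poly_map S q (poly_map S l x) = 0"
      using less.prems(2) by (simp add: q poly_map_mult[OF S(1)])
    ultimately show ?thesis
      using less.hyps[of q "poly_map S l x"] \<open>q \<noteq> 0\<close> False in_U less.prems(4) by blast
  qed
  \<comment> \<open>A nonzero constant cannot annihilate the nonzero vector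
    \<open>x\<close>.\<close>
  have "\<not> constant (poly (map_poly complex_of_real p))"
  proof
    assume "constant (poly (map_poly complex_of_real p))"
    then have "degree (map_poly complex_of_real p) = 0" by (simp add: constant_degree)
    then have "degree p = 0" by (simp add: degree_map_poly)
    then obtain c where "p = [:c:]" by (rule degree_eq_zeroE)
    then show False using less.prems by (simp add: poly_map_pCons[OF S(1)] linear_0[OF S(1)])
  qed
  then obtain \<mu> where \<mu>: "poly (map_poly complex_of_real p) \<mu> = 0"
    using fundamental_theorem_of_algebra by blast
  have lm: "linear (\<lambda>w. \<mu> * w)"
    by (simp add: bounded_linear.linear bounded_linear_mult_right)
  define a b where "a = Re \<mu>" and "b = Im \<mu>"
  show ?case
  proof (cases "b = 0")
    case True
    then have "\<mu> = of_real a" by (simp add: a_def b_def complex_eq_iff)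
    have "poly (map_poly complex_of_real q) (of_real a) = of_real (poly q a)" for q
      by (induction q) (simp_all add: map_poly_pCons)
    then have "poly p a = 0" using \<mu> \<open>\<mu> = of_real a\<close> by simp
    then have dvd: "[:- a, 1:] dvd p" by (simp add: poly_eq_0_iff_dvd)
    show ?thesis
    proof (rule factor[OF dvd])
      fix y assume y: "y \<in> U" "y \<noteq> 0" "poly_map S [:- a, 1:] y = 0"
      have "S y = a *\<^sub>R y"
        using y(3) by (simp add: poly_map_pCons[OF S(1)] linear_0[OF S(1)])
      then show ?thesis using y(1,2) by blast
    qed simp
  next
    case False
    \<comment> \<open>This is the minimal polynomial of \<open>\<mu> = a + i b\<close> over the
      reals.\<close>
    define l where "l = [:a\<^sup>2 + b\<^sup>2, - (2 * a), 1:]"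
    have l0: "poly_map (\<lambda>w. \<mu> * w) l 1 = 0"
      unfolding l_def poly_map_pCons[OF lm] poly_map_0
      by (simp add: a_def b_def complex_eq_iff power2_eq_square algebra_simps)
    have "degree (p mod l) < 2"
      using degree_mod_less[of l p] by (auto simp: l_def)
    define c d where "c = coeff (p mod l) 0" and "d = coeff (p mod l) 1"
    have cd: "p mod l = [:c, d:]"
    proof (rule poly_eqI)
      fix n
      show "coeff (p mod l) n = coeff [:c, d:] n"
      proof (cases "n < 2")
        case True
        then show ?thesis by (auto simp: c_def d_def less_2_cases_iff)
      next
        case False
        then show ?thesis
          using \<open>degree (p mod l) < 2\<close> by (simp add: coeff_eq_0 coeff_pCons split: nat.split)
      qed
    qed
    \<comment> \<open>The remainder \<open>c + d t\<close> vanishes at the non-real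
      \<open>\<mu>\<close>, so comparing imaginary parts kills \<open>d\<close>, and then
      \<open>c\<close> vanishes too.\<close>
    have "poly_map (\<lambda>w. \<mu> * w) ((p div l) * l + p mod l) 1 = 0"
      using \<mu>[folded poly_map_complex] by simp
    then have "poly_map (\<lambda>w. \<mu> * w) (p mod l) 1 = 0"
      by (simp only: poly_map_add[OF lm] poly_map_mult[OF lm] l0 poly_map_at_0[OF lm]) simp
    then have "of_real c + \<mu> * of_real d = 0"
      by (simp add: cd poly_map_pCons[OF lm] scaleR_conv_of_real)
    then have "d = 0" "c = 0" using False by (auto simp: complex_eq_iff b_def)
    then have dvd: "l dvd p" using cd by (simp add: mod_eq_0_iff_dvd)
    show ?thesis
    proof (rule factor[OF dvd])
      show "degree l > 0" by (simp add: l_def)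
      fix y assume y: "y \<in> U" "y \<noteq> 0" "poly_map S l y = 0"
      have "S (S y) = (2 * a) *\<^sub>R S y - (a\<^sup>2 + b\<^sup>2) *\<^sub>R y"
        using y(3) by (simp add: l_def poly_map_pCons[OF S(1)] linear_0[OF S(1)]
            linear_add[OF S(1)] linear_diff[OF S(1)] linear_neg[OF S(1)] linear_scale[OF S(1)] algebra_simps)
      then show ?thesis using y(1,2) False by blast
    qed
  qed
qed

section \<open>Non-degenerate symmetric forms\<close>

lemma rs_form_commute: "rs_form r s x y = rs_form r s y x"
  unfolding rs_form_def by (simp add: mult.commute)

lemma rs_form_linear: "linear (rs_form r s x)"
  unfolding rs_form_def
  by (rule linearI) (simp_all add: algebra_simps sum.distrib sum_distrib_left)

lemmas rs_form_add_right = linear_add[OF rs_form_linear]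
lemmas rs_form_scale_right = linear_scale[OF rs_form_linear, unfolded real_scaleR_def]
lemmas rs_form_minus_right = linear_neg[OF rs_form_linear]

lemma rs_form_add_left: "rs_form r s (x + y) w = rs_form r s x w + rs_form r s y w"
  by (simp only: rs_form_commute[of r s _ w] rs_form_add_right)

lemma rs_form_minus_left: "rs_form r s (- x) y = - rs_form r s x y"
  by (simp only: rs_form_commute[of r s _ y] rs_form_minus_right)

lemma coord_pos_less_CARD: "coord_pos (i :: 'n::{finite,linorder}) < CARD('n)"
  unfolding coord_pos_def by (rule psubset_card_mono) auto

lemma rs_form_axis:
  fixes w :: "real ^ 'n::{finite,linorder}"
  assumes "CARD('n) = r + s"
  shows "rs_form r s (axis i 1) w = (if coord_pos i < r then w $ i else - w $ i)"
proof -
  have "coord_pos i < r + s" using coord_pos_less_CARD[of i] assms by simp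
  moreover have "(\<Sum>j\<in>A. axis i 1 $ j * w $ j) = (if i \<in> A then w $ i else 0)" for A
  proof -
    have "(\<Sum>j\<in>A. axis i 1 $ j * w $ j) = (\<Sum>j\<in>A. if j = i then w $ j else 0)"
      by (intro sum.cong) (auto simp: axis_def)
    then show ?thesis by simp
  qed
  ultimately show ?thesis unfolding rs_form_def by auto
qed

lemma rs_form_nondegenerate:
  fixes w :: "real ^ 'n::{finite,linorder}"
  assumes "CARD('n) = r + s" "\<And>z. rs_form r s z w = rs_form r s z w'"
  shows "w = w'"
proof (rule vec_eq_iff[THEN iffD2], rule allI)
  fix i
  show "w $ i = w' $ i"
    using assms(2)[of "axis i 1"] by (simp add: rs_form_axis[OF assms(1)] split: if_splits)
qed

lemma rs_form_riesz:
  fixes f :: "real ^ 'n::{finite,linorder} \<Rightarrow> real"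
  assumes "CARD('n) = r + s" "linear f"
  shows "\<exists>w. \<forall>z. f z = rs_form r s z w"
proof -
  \<comment> \<open>In a negative direction the form changes the sign of the coordinate, and the
    representing vector compensates for it.\<close>
  define w where "w = (\<chi> i. if coord_pos i < r then f (axis i 1) else - f (axis i 1))"
  have eq: "f (axis i 1) = rs_form r s (axis i 1) w" for i
    by (simp add: rs_form_axis[OF assms(1)] w_def)
  have "f z = rs_form r s w z" for z
  proof (rule linear_eq_on[OF assms(2) rs_form_linear])
    show "z \<in> span Basis" by simp
    show "f b = rs_form r s w b" if "b \<in> Basis" for b
      using that eq rs_form_commute[of r s w b] by (auto simp: Basis_vec_def)
  qed
  then show ?thesis by (metis rs_form_commute)
qed

section \<open>Spaces with a non-degenerate form: Riesz representation and dual bases\<close>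

locale form_space =
  fixes U :: "'u::real_vector set" and B :: "'u \<Rightarrow> 'u \<Rightarrow> real"
  assumes finite_dim: "finite_dim_subspace U"
    and form: "nondegenerate_symmetric_form U B"
begin

lemma sub: "subspace U"
  using finite_dim by (rule finite_dim_subspace_imp_subspace)

lemmas U_closed = subspace_0[OF sub] subspace_add[OF sub] subspace_diff[OF sub] subspace_neg[OF sub]
  subspace_scale[OF sub] subspace_sum[OF sub]

lemma B_linear: "x \<in> U \<Longrightarrow> linear_on_subspace U (B x)"
  using form by (simp add: nondegenerate_symmetric_form_def)

lemma B_commute: "x \<in> U \<Longrightarrow> y \<in> U \<Longrightarrow> B x y = B y x"
  using form unfolding nondegenerate_symmetric_form_def by metis

lemma B_nondegenerate: "x \<in> U \<Longrightarrow> (\<And>y. y \<in> U \<Longrightarrow> B x y = 0) \<Longrightarrow> x = 0"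
  using form by (simp add: nondegenerate_symmetric_form_def)

lemma B_add_right: "x \<in> U \<Longrightarrow> y \<in> U \<Longrightarrow> w \<in> U \<Longrightarrow> B x (y + w) = B x y + B x w"
  by (rule linear_on_subspace_add[OF B_linear])

lemma B_scale_right: "x \<in> U \<Longrightarrow> y \<in> U \<Longrightarrow> B x (c *\<^sub>R y) = c * B x y"
  using linear_on_subspace_scale[OF B_linear] by simp

lemma B_minus_right: "x \<in> U \<Longrightarrow> y \<in> U \<Longrightarrow> B x (- y) = - B x y"
  by (rule linear_on_subspace_neg[OF B_linear])

lemma B_diff_right: "x \<in> U \<Longrightarrow> y \<in> U \<Longrightarrow> w \<in> U \<Longrightarrow> B x (y - w) = B x y - B x w"
  using B_add_right[of x y "- w"] B_minus_right[of x w] by (simp add: U_closed)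

lemma B_sum_right: "x \<in> U \<Longrightarrow> (\<And>i. i \<in> I \<Longrightarrow> g i \<in> U) \<Longrightarrow> B x (\<Sum>i\<in>I. g i) = (\<Sum>i\<in>I. B x (g i))"
  by (rule linear_on_subspace_sum[OF B_linear sub])

lemma B_add_left: "x \<in> U \<Longrightarrow> y \<in> U \<Longrightarrow> w \<in> U \<Longrightarrow> B (x + y) w = B x w + B y w"
  using B_add_right[of w x y] by (simp add: B_commute[of w] U_closed)

lemma B_scale_left: "x \<in> U \<Longrightarrow> y \<in> U \<Longrightarrow> B (c *\<^sub>R x) y = c * B x y"
  using B_scale_right[of y x c] by (simp add: B_commute[of y] U_closed)

lemma B_minus_left: "x \<in> U \<Longrightarrow> y \<in> U \<Longrightarrow> B (- x) y = - B x y"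
  using B_minus_right[of y x] by (simp add: B_commute[of y] U_closed)

lemma B_diff_left: "x \<in> U \<Longrightarrow> y \<in> U \<Longrightarrow> w \<in> U \<Longrightarrow> B (x - y) w = B x w - B y w"
  using B_diff_right[of w x y] by (simp add: B_commute[of w] U_closed)

lemma B_eqI: "x \<in> U \<Longrightarrow> x' \<in> U \<Longrightarrow> (\<And>y. y \<in> U \<Longrightarrow> B x y = B x' y) \<Longrightarrow> x = x'"
  using B_nondegenerate[of "x - x'"] by (simp add: B_diff_left U_closed)

text \<open>By polarization, a form with \<open>B u u = 0\<close> throughout \<open>U\<close> is
  zero, which non-degeneracy excludes on a nonzero space.\<close>

lemma nonisotropic:
  assumes "U \<noteq> {0}"
  obtains u where "u \<in> U" "B u u \<noteq> 0"
proof (rule ccontr)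
  assume "\<not> thesis"
  then have iso: "\<And>u. u \<in> U \<Longrightarrow> B u u = 0" using that by auto
  have "B x y = 0" if "x \<in> U" "y \<in> U" for x y
    using iso[of "x + y"] iso[of x] iso[of y] that B_commute[of x y]
    by (simp add: B_add_left B_add_right U_closed)
  then have "x = 0" if "x \<in> U" for x using B_nondegenerate[of x] that by simp
  then show False using assms subspace_0[OF sub] by blast
qed

text \<open>The Gram map \<open>G\<close> records the values \<open>B x e\<close> on a basis.
  Non-degeneracy makes it injective on \<open>U\<close>, hence onto, so the prescribed values
  \<open>f e\<close> are attained.\<close>

lemma riesz:
  assumes "linear_on_subspace U f"
  shows "\<exists>u\<in>U. \<forall>y\<in>U. B u y = f y"
proof -
  obtain E where E: "finite E" "independent E" "span E = U" "E \<subseteq> U"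
    using finite_dim_subspaceE[OF finite_dim] .
  have on_basis: "h y = k y"
    if "linear_on_subspace U h" "linear_on_subspace U k" "\<And>e. e \<in> E \<Longrightarrow> h e = k e" "y \<in> U"
    for h k :: "'u \<Rightarrow> real" and y
  proof -
    obtain c where c: "y = (\<Sum>e\<in>E. c e *\<^sub>R e)"
      using \<open>y \<in> U\<close> E span_finite[of E] by auto
    have ce: "c e *\<^sub>R e \<in> U" if "e \<in> E" for e
      using that E(4) sub by (auto intro: subspace_scale)
    have "h y = (\<Sum>e\<in>E. c e *\<^sub>R h e)" "k y = (\<Sum>e\<in>E. c e *\<^sub>R k e)"
      unfolding c using E(4) that(1,2) ce
      by (simp_all add: linear_on_subspace_sum[OF _ sub] linear_on_subspace_scale subset_iff)
    then show ?thesis using that(3) by simp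
  qed
  define G where "G x = (\<Sum>e\<in>E. B x e *\<^sub>R e)" for x
  have "linear_on_subspace U G"
    unfolding linear_on_subspace_def G_def
  proof (intro conjI ballI allI)
    fix x y assume xy: "x \<in> U" "y \<in> U"
    have "B (x + y) e = B x e + B y e" if "e \<in> E" for e
    proof -
      have "e \<in> U" using that E(4) by blast
      then show ?thesis
        using xy by (simp add: B_add_left)
    qed
    then show "(\<Sum>e\<in>E. B (x + y) e *\<^sub>R e) = (\<Sum>e\<in>E. B x e *\<^sub>R e) + (\<Sum>e\<in>E. B y e *\<^sub>R e)"
      by (simp add: scaleR_left_distrib sum.distrib)
  next
    fix c x assume x: "x \<in> U"
    have "B (c *\<^sub>R x) e = c * B x e" if "e \<in> E" for e
    proof -
      have "e \<in> U" using that E(4) by blast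
      then show ?thesis
        using x by (simp add: B_scale_left)
    qed
    then show "(\<Sum>e\<in>E. B (c *\<^sub>R x) e *\<^sub>R e) = c *\<^sub>R (\<Sum>e\<in>E. B x e *\<^sub>R e)"
      by (simp add: scaleR_sum_right)
  qed
  then obtain g where g: "linear g" "\<And>x. x \<in> U \<Longrightarrow> g x = G x"
    using linear_on_subspace_extend finite_dim by blast
  have coeff: "\<forall>e\<in>E. a e = b e" if "(\<Sum>e\<in>E. a e *\<^sub>R e) = (\<Sum>e\<in>E. b e *\<^sub>R e)" for a b :: "'u \<Rightarrow> real"
  proof -
    have "(\<Sum>e\<in>E. (a e - b e) *\<^sub>R e) = 0"
      using that by (simp add: scaleR_left_diff_distrib sum_subtractf)
    then show ?thesis using independentD[OF E(2) E(1) order_refl, of "\<lambda>e. a e - b e"] by simp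
  qed
  have "inj_on g U"
    unfolding linear_inj_on_iff_eq_0[OF g(1) sub]
  proof (intro ballI impI)
    fix x assume x: "x \<in> U" "g x = 0"
    then have "(\<Sum>e\<in>E. B x e *\<^sub>R e) = (\<Sum>e\<in>E. 0 *\<^sub>R e)" using g(2) by (simp add: G_def)
    from coeff[OF this] have "\<forall>e\<in>E. B x e = 0" .
    then have "B x y = 0" if "y \<in> U" for y
      using on_basis[OF B_linear[OF x(1)], of "\<lambda>_. 0"] that by (simp add: linear_on_subspace_def)
    then show "x = 0" using B_nondegenerate[of x] x by simp
  qed
  moreover have "g ` U \<subseteq> U"
    using g(2) E(4) sub by (auto simp: G_def intro!: subspace_sum subspace_scale)
  ultimately have "g ` U = U" using inj_on_subspace_surj[OF g(1) finite_dim] by blast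
  moreover have "(\<Sum>e\<in>E. f e *\<^sub>R e) \<in> U" using E(4) sub by (auto intro!: subspace_sum subspace_scale)
  ultimately obtain u where u: "u \<in> U" "g u = (\<Sum>e\<in>E. f e *\<^sub>R e)" by (metis imageE)
  then have "\<forall>e\<in>E. B u e = f e" using coeff g(2) by (simp add: G_def)
  then show ?thesis using on_basis[OF B_linear[OF u(1)] assms] u(1) by blast
qed

text \<open>Duality of \<open>E\<close> and \<open>d\<close> is encoded by the two expansions of a
  vector, since traces are computed by expanding in one family or the other.\<close>

definition dual_bases :: "'u set \<Rightarrow> ('u \<Rightarrow> 'u) \<Rightarrow> bool" where
  "dual_bases E d \<longleftrightarrow> finite E \<and> E \<subseteq> U \<and> d ` E \<subseteq> U \<and>
     (\<forall>x\<in>U. (\<Sum>e\<in>E. B (d e) x *\<^sub>R e) = x) \<and> (\<forall>x\<in>U. (\<Sum>e\<in>E. B e x *\<^sub>R d e) = x)"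

text \<open>\<open>d e\<close> represents the coordinate functional of \<open>e\<close>, which gives
  the first expansion. Pairing with an arbitrary \<open>y\<close> and expanding \<open>y\<close>
  yields the second.\<close>

lemma dual_bases_exist: "\<exists>E d. dual_bases E d"
proof -
  obtain E where E: "finite E" "independent E" "span E = U" "E \<subseteq> U"
    using finite_dim_subspaceE[OF finite_dim] .
  have "linear_on_subspace U (\<lambda>x. representation E x e)" for e
    using E by (simp add: linear_on_subspace_def real_vector.representation_add real_vector.representation_scale)
  then have "\<forall>e. \<exists>u\<in>U. \<forall>y\<in>U. B u y = representation E y e"
    using riesz by blast
  then obtain d where d: "\<And>e. d e \<in> U" "\<And>e y. y \<in> U \<Longrightarrow> B (d e) y = representation E y e"
    by metis
  have 1: "(\<Sum>e\<in>E. B (d e) x *\<^sub>R e) = x" if "x \<in> U" for x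
    using real_vector.sum_representation_eq[OF E(2), of x E] E(1,3) that d(2)[OF that] by simp
  have 2: "(\<Sum>e\<in>E. B e x *\<^sub>R d e) = x" if x: "x \<in> U" for x
  proof (rule B_eqI)
    show "(\<Sum>e\<in>E. B e x *\<^sub>R d e) \<in> U" using d(1) by (simp add: U_closed)
    fix y assume y: "y \<in> U"
    have "B (\<Sum>e\<in>E. B e x *\<^sub>R d e) y = B y (\<Sum>e\<in>E. B e x *\<^sub>R d e)"
      using d(1) y by (intro B_commute) (simp_all add: U_closed)
    also have "\<dots> = (\<Sum>e\<in>E. B e x * B (d e) y)"
      using d(1) y by (simp add: B_sum_right B_scale_right U_closed B_commute[of y])
    also have "\<dots> = B x (\<Sum>e\<in>E. B (d e) y *\<^sub>R e)"
      using E(4) x by (simp add: B_sum_right B_scale_right U_closed subset_iff B_commute[of x] mult.commute)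
    also have "\<dots> = B x y" using 1[OF y] by simp
    finally show "B (\<Sum>e\<in>E. B e x *\<^sub>R d e) y = B x y" .
  qed (use x in simp)
  have "d ` E \<subseteq> U" using d(1) by blast
  then have "dual_bases E d" using E 1 2 by (simp add: dual_bases_def)
  then show ?thesis by blast
qed

end

section \<open>Admissible modules\<close>

locale admissible = form_space U B
  for r s :: nat and U :: "'u::real_vector set"
    and J :: "real ^ 'n::{finite,linorder} \<Rightarrow> 'u \<Rightarrow> 'u" and B +
  assumes clifford: "clifford_module r s U J"
    and J_skew_sum: "\<And>z x y. x \<in> U \<Longrightarrow> y \<in> U \<Longrightarrow> B (J z x) y + B x (J z y) = 0"
begin

lemma J_linear: "linear_on_subspace U (J z)"
  using clifford by (simp add: clifford_module_def)

lemma J_in: "x \<in> U \<Longrightarrow> J z x \<in> U"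
  using clifford by (auto simp: clifford_module_def)

lemma J_linear_vec: "x \<in> U \<Longrightarrow> linear (\<lambda>z. J z x)"
  using clifford by (simp add: clifford_module_def)

lemma J_J: "x \<in> U \<Longrightarrow> J z (J z x) = - rs_form r s z z *\<^sub>R x"
  using clifford by (simp add: clifford_module_def)

lemmas J_add = linear_on_subspace_add[OF J_linear]
lemmas J_scale = linear_on_subspace_scale[OF J_linear]
lemmas J_minus = linear_on_subspace_neg[OF J_linear]

lemma J_skew: "x \<in> U \<Longrightarrow> y \<in> U \<Longrightarrow> B (J z x) y = - B x (J z y)"
  using J_skew_sum[of x y z] by simp

text \<open>Polarization: compare the square of \<open>J (z + w)\<close> with the sum of the squares
  of \<open>J z\<close> and \<open>J w\<close>.\<close>

lemma J_anticommute:
  assumes "rs_form r s z w = 0" "x \<in> U"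
  shows "J z (J w x) = - J w (J z x)"
proof -
  have lin: "J (z + w) y = J z y + J w y" if "y \<in> U" for y
    using linear_add[OF J_linear_vec[OF that]] .
  have "J (z + w) (J (z + w) x) = J z (J z x) + J z (J w x) + (J w (J z x) + J w (J w x))"
    using assms(2) by (simp add: lin J_in J_add U_closed)
  moreover have "rs_form r s (z + w) (z + w) = rs_form r s z z + rs_form r s w w"
    using assms(1) rs_form_commute[of r s w z] by (simp add: rs_form_add_left rs_form_add_right)
  ultimately have "J z (J w x) + J w (J z x) = 0"
    using assms(2) by (simp add: J_J algebra_simps)
  then show ?thesis by (simp add: eq_neg_iff_add_eq_0)
qed

text \<open>The form on the image sends \<open>(S x, S y)\<close> to \<open>B x (S y)\<close>; it is well defined and
  non-degenerate because \<open>S\<close> is self-adjoint.\<close>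

lemma admissible_image:
  assumes S: "linear S" "S ` U \<subseteq> U"
    and comm: "\<And>z x. x \<in> U \<Longrightarrow> S (J z x) = J z (S x)"
    and adj: "\<And>x y. x \<in> U \<Longrightarrow> y \<in> U \<Longrightarrow> B (S x) y = B x (S y)"
  shows "\<exists>B'. admissible_module r s (S ` U) J B'"
proof -
  have SU: "S x \<in> U" if "x \<in> U" for x using that S(2) by blast
  define pre where "pre u = (SOME x. x \<in> U \<and> S x = u)" for u
  have pre: "pre (S x) \<in> U" "S (pre (S x)) = S x" if "x \<in> U" for x
    using someI_ex[of "\<lambda>y. y \<in> U \<and> S y = S x"] that unfolding pre_def by blast+
  define B' where "B' u v = B (pre u) v" for u v
  have B': "B' (S x) (S y) = B x (S y)" if "x \<in> U" "y \<in> U" for x y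
    using adj[of "pre (S x)" y] adj[of x y] pre[of x] that by (simp add: B'_def)
  have "finite_dim_subspace (S ` U)"
    using finite_dim linear_span_image[OF S(1)] unfolding finite_dim_subspace_def
    by (metis finite_imageI)
  moreover have "linear_on_subspace (S ` U) (J z)" for z
    using J_linear[of z] S(2) unfolding linear_on_subspace_def by blast
  moreover have "J z (S x) \<in> S ` U" if "x \<in> U" for z x
    using comm[OF that, of z] J_in[OF that, of z] by (metis imageI)
  ultimately have "clifford_module r s (S ` U) J"
    using SU by (auto simp: clifford_module_def J_linear_vec J_J)
  moreover have "nondegenerate_symmetric_form (S ` U) B'"
    unfolding nondegenerate_symmetric_form_def
  proof (intro conjI ballI impI)
    fix u assume "u \<in> S ` U"
    then obtain x where x: "x \<in> U" "u = S x" by blast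
    show "linear_on_subspace (S ` U) (B' u)"
      unfolding linear_on_subspace_def
      using x SU pre(1) by (auto simp: B'_def B_add_right B_scale_right)
  next
    fix u v assume "u \<in> S ` U" "v \<in> S ` U"
    then obtain x y where "x \<in> U" "u = S x" "y \<in> U" "v = S y" by blast
    then show "B' u v = B' v u" using adj[of x y] SU B_commute[of "S x" y] by (simp add: B')
  next
    fix u assume "u \<in> S ` U" and zero: "\<forall>v\<in>S ` U. B' u v = 0"
    then obtain x where x: "x \<in> U" "u = S x" by blast
    have "B (S x) y = 0" if "y \<in> U" for y
      using zero x that B'[of x y] adj[of x y] by simp
    then show "u = 0" using B_nondegenerate[of "S x"] x SU by simp
  qed
  moreover have "B' (J z u) v + B' u (J z v) = 0" if uv: "u \<in> S ` U" "v \<in> S ` U" for z u v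
  proof -
    obtain x y where xy: "x \<in> U" "u = S x" "y \<in> U" "v = S y" using uv by blast
    have "B' (S (J z x)) (S y) + B' (S x) (S (J z y)) = 0"
      using xy J_skew_sum[of x "S y" z] SU B'[of "J z x" y] B'[of x "J z y"] by (simp add: J_in comm)
    then show ?thesis using xy comm by simp
  qed
  ultimately show ?thesis unfolding admissible_module_def by blast
qed

text \<open>The sum is the trace of \<open>F\<close> with respect to \<open>B\<close>, and \<open>J z\<close> scales \<open>B\<close> by
  \<open>rs_form r s z z\<close>.\<close>

lemma trace_J:
  fixes F :: "'u \<Rightarrow> 'u \<Rightarrow> real"
  assumes dual: "dual_bases E d"
    and F: "\<And>y. y \<in> U \<Longrightarrow> linear_on_subspace U (\<lambda>x. F x y)"
      "\<And>x. x \<in> U \<Longrightarrow> linear_on_subspace U (F x)"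
  shows "(\<Sum>e\<in>E. F (J z e) (J z (d e))) = rs_form r s z z * (\<Sum>e\<in>E. F e (d e))"
proof -
  have expand: "(\<Sum>e\<in>E. B (d e) x *\<^sub>R e) = x" "(\<Sum>e\<in>E. B e x *\<^sub>R d e) = x" if "x \<in> U" for x
    using that dual by (simp_all add: dual_bases_def)
  have eU: "e \<in> U" "d e \<in> U" if "e \<in> E" for e using that dual by (auto simp: dual_bases_def)
  have Fl: "F (\<Sum>e\<in>E. c e *\<^sub>R e) y = (\<Sum>e\<in>E. c e * F e y)" if "y \<in> U" for c y
    using linear_on_subspace_sum[OF F(1)[OF that] sub, of E "\<lambda>e. c e *\<^sub>R e"]
      linear_on_subspace_scale[OF F(1)[OF that]] eU(1) by (simp add: U_closed)
  have Fr: "F x (\<Sum>e\<in>E. c e *\<^sub>R d e) = (\<Sum>e\<in>E. c e * F x (d e))" if "x \<in> U" for c x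
    using linear_on_subspace_sum[OF F(2)[OF that] sub, of E "\<lambda>e. c e *\<^sub>R d e"]
      linear_on_subspace_scale[OF F(2)[OF that]] eU(2) by (simp add: U_closed)
  have Fr': "F x (\<Sum>e\<in>E. c e *\<^sub>R J z (d e)) = (\<Sum>e\<in>E. c e * F x (J z (d e)))" if "x \<in> U" for c x
    using linear_on_subspace_sum[OF F(2)[OF that] sub, of E "\<lambda>e. c e *\<^sub>R J z (d e)"]
      linear_on_subspace_scale[OF F(2)[OF that]] eU(2) by (simp add: U_closed J_in)
  \<comment> \<open>Expand \<open>J z e\<close> in \<open>E\<close> and exchange the sums. The inner
    sum over \<open>e\<close> then rebuilds \<open>- J z (J z (d k))\<close> in the second argument,
    which is \<open>d k\<close> scaled by \<open>rs_form r s z z\<close>.\<close>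
  have "(\<Sum>e\<in>E. F (J z e) (J z (d e))) = (\<Sum>e\<in>E. \<Sum>k\<in>E. B (d k) (J z e) * F k (J z (d e)))"
  proof (intro sum.cong refl)
    fix e assume "e \<in> E"
    then show "F (J z e) (J z (d e)) = (\<Sum>k\<in>E. B (d k) (J z e) * F k (J z (d e)))"
      using Fl[of "J z (d e)" "\<lambda>k. B (d k) (J z e)"] expand(1)[of "J z e"] eU by (simp add: J_in)
  qed
  also have "\<dots> = (\<Sum>k\<in>E. \<Sum>e\<in>E. B (d k) (J z e) * F k (J z (d e)))"
    by (rule sum.swap)
  also have "\<dots> = (\<Sum>k\<in>E. rs_form r s z z * F k (d k))"
  proof (intro sum.cong refl)
    fix k assume k: "k \<in> E"
    have "(\<Sum>e\<in>E. B (d k) (J z e) *\<^sub>R J z (d e)) = J z (\<Sum>e\<in>E. B (d k) (J z e) *\<^sub>R d e)"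
      using linear_on_subspace_sum[OF J_linear[of z] sub, of E "\<lambda>e. B (d k) (J z e) *\<^sub>R d e"]
        eU by (simp add: U_closed J_scale)
    also have "(\<Sum>e\<in>E. B (d k) (J z e) *\<^sub>R d e) = - J z (d k)"
    proof -
      have "B (d k) (J z e) = - B e (J z (d k))" if "e \<in> E" for e
        using J_skew[of "d k" e z] B_commute[of e "J z (d k)"] eU k that by (simp add: J_in)
      then show ?thesis
        using expand(2)[of "J z (d k)"] eU(2)[OF k] by (simp add: J_in sum_negf)
    qed
    also have "J z (- J z (d k)) = rs_form r s z z *\<^sub>R d k"
      using eU(2)[OF k] by (simp add: J_minus J_in J_J)
    finally have *: "(\<Sum>e\<in>E. B (d k) (J z e) *\<^sub>R J z (d e)) = rs_form r s z z *\<^sub>R d k" .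
    show "(\<Sum>e\<in>E. B (d k) (J z e) * F k (J z (d e))) = rs_form r s z z * F k (d k)"
      using Fr'[of k "\<lambda>e. B (d k) (J z e)"] * eU[OF k]
        linear_on_subspace_scale[OF F(2)[OF eU(1)[OF k]] eU(2)[OF k], of "rs_form r s z z"] by simp
  qed
  finally show ?thesis by (simp add: sum_distrib_left)
qed

text \<open>The witness \<open>W\<close> is the product of the \<open>J (z i)\<close> with \<open>i \<in> M\<close>.\<close>

lemma subset_product:
  assumes "finite M" "M \<subseteq> I"
    and orth: "\<And>i j. i \<in> I \<Longrightarrow> j \<in> I \<Longrightarrow> i \<noteq> j \<Longrightarrow> rs_form r s (z i) (z j) = 0"
    and unit: "\<And>i. i \<in> I \<Longrightarrow> \<bar>rs_form r s (z i) (z i)\<bar> = 1"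
  shows "\<exists>W. linear_on_subspace U W \<and> W ` U = U \<and>
    (\<forall>i\<in>I. \<forall>x\<in>U. J (z i) (W x) = (- 1) ^ card (M - {i}) *\<^sub>R W (J (z i) x))"
  using assms(1,2)
proof (induction M)
  case empty
  show ?case by (intro exI[of _ "\<lambda>x. x"]) (simp add: linear_on_subspace_def)
next
  case (insert m M)
  then obtain W where W: "linear_on_subspace U W" "W ` U = U"
    "\<And>i x. i \<in> I \<Longrightarrow> x \<in> U \<Longrightarrow> J (z i) (W x) = (- 1) ^ card (M - {i}) *\<^sub>R W (J (z i) x)"
    by auto
  have m: "m \<in> I" using insert.prems by simp
  have WU: "W x \<in> U" if "x \<in> U" for x using W(2) that by blast
  have "J (z m) ` U = U"
  proof (intro equalityI subsetI)
    fix u assume u: "u \<in> U"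
    let ?q = "rs_form r s (z m) (z m)"
    have "?q * ?q = 1" using unit[OF m] by (metis abs_mult_self_eq mult_1)
    \<comment> \<open>\<open>J (z m)\<close> squares to minus \<open>?q\<close>, and
      \<open>?q\<close> is its own inverse, so this exhibits a preimage of \<open>u\<close>.\<close>
    then have "J (z m) ((- ?q) *\<^sub>R J (z m) u) = u" using u by (simp only: J_scale J_in J_J) simp
    then show "u \<in> J (z m) ` U" using u by (metis J_in U_closed(5) imageI)
  qed (use J_in in blast)
  then have "(\<lambda>x. J (z m) (W x)) ` U = U" using W(2) by (metis image_image)
  moreover have "linear_on_subspace U (\<lambda>x. J (z m) (W x))"
    using linear_on_subspace_compose[OF W(1) J_linear] WU by blast
  \<comment> \<open>Moving \<open>J (z i)\<close> past the new factor costs a sign exactly when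
    \<open>i\<close> differs from \<open>m\<close>, which is also when \<open>M - {i}\<close>
    grows.\<close>
  moreover have "J (z i) (J (z m) (W x)) = (- 1) ^ card (insert m M - {i}) *\<^sub>R J (z m) (W (J (z i) x))"
    if i: "i \<in> I" and x: "x \<in> U" for i x
  proof (cases "i = m")
    case True
    have "insert m M - {m} = M - {m}" by blast
    then show ?thesis using True W(3)[OF m x] x by (simp add: J_scale WU J_in)
  next
    case False
    then have "insert m M - {i} = insert m (M - {i})" by blast
    then have "card (insert m M - {i}) = Suc (card (M - {i}))"
      using insert.hyps by simp
    then show ?thesis
      using J_anticommute[of "z i" "z m" "W x"] orth[OF i m False] W(3)[OF i x] x
      by (simp add: J_scale WU J_in)
  qed
  ultimately show ?case by blast
qed

lemma volume_form_in: "x \<in> U \<Longrightarrow> foldr (\<lambda>j f. J (z j) \<circ> f) L id x \<in> U"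
  by (induction L) (simp_all add: J_in)

end

lemma admissible_iff: "admissible_module r s U J B \<longleftrightarrow> admissible r s U J B"
  unfolding admissible_module_def admissible_def admissible_axioms_def form_space_def clifford_module_def
  by auto

section \<open>Intertwining maps\<close>

text \<open>The trace form \<open>tr\<close> of \<open>B'\<close> along \<open>T\<close> is invariant under \<open>\<Phi> = (T \<mapsto> J' T J)\<close>, so by the
  parallelogram law it cannot vanish on both \<open>T + \<Phi>\<close> and \<open>T - \<Phi>\<close>. The induction starts from a
  map of rank one.\<close>

lemma signed_intertwiner:
  fixes J :: "real ^ 'n::{finite,linorder} \<Rightarrow> 'u::real_vector \<Rightarrow> 'u"
    and J' :: "real ^ 'n::{finite,linorder} \<Rightarrow> 'v::real_vector \<Rightarrow> 'v"
    and z :: "nat \<Rightarrow> real ^ 'n::{finite,linorder}"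
  assumes "admissible r s U J B" "admissible r s U' J' B'" "U \<noteq> {0}" "U' \<noteq> {0}"
    and "finite I"
    and "\<And>i j. i \<in> I \<Longrightarrow> j \<in> I \<Longrightarrow> i \<noteq> j \<Longrightarrow> rs_form r s (z i) (z j) = 0"
    and "\<And>i. i \<in> I \<Longrightarrow> \<bar>rs_form r s (z i) (z i)\<bar> = 1"
  shows "\<exists>T \<epsilon>. linear_on_subspace U T \<and> T ` U \<subseteq> U' \<and>
    (\<forall>i\<in>I. \<bar>\<epsilon> i\<bar> = 1 \<and> (\<forall>x\<in>U. J' (z i) (T x) = \<epsilon> i *\<^sub>R T (J (z i) x))) \<and>
    (\<exists>x\<in>U. \<exists>y\<in>U. B' (T x) (T y) \<noteq> 0)"
proof -
  interpret M: admissible r s U J B by fact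
  interpret M': admissible r s U' J' B' by fact
  obtain E d where Ed: "M.dual_bases E d" using M.dual_bases_exist by blast
  have eU: "e \<in> U" "d e \<in> U" if "e \<in> E" for e using that Ed by (auto simp: M.dual_bases_def)
  define tr where "tr T = (\<Sum>e\<in>E. B' (T e) (T (d e)))" for T :: "'u \<Rightarrow> 'v"
  have "\<exists>T \<epsilon>. linear_on_subspace U T \<and> T ` U \<subseteq> U' \<and>
    (\<forall>i\<in>I. \<bar>\<epsilon> i\<bar> = (1::real) \<and> (\<forall>x\<in>U. J' (z i) (T x) = \<epsilon> i *\<^sub>R T (J (z i) x))) \<and> tr T \<noteq> 0"
    using assms(5-)
  proof (induction I)
    case empty
    obtain u where u: "u \<in> U" "B u u \<noteq> 0" using M.nonisotropic[OF assms(3)] .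
    obtain v where v: "v \<in> U'" "B' v v \<noteq> 0" using M'.nonisotropic[OF assms(4)] .
    define T where "T x = B u x *\<^sub>R v" for x
    \<comment> \<open>For this map of rank one the expansion of \<open>u\<close> collapses the trace
      to \<open>B u u * B' v v\<close>.\<close>
    have "tr T = (\<Sum>e\<in>E. B u e * B u (d e)) * B' v v"
      unfolding sum_distrib_right tr_def T_def
      using v(1) by (intro sum.cong) (simp_all add: M'.B_scale_left M'.B_scale_right M'.U_closed)
    also have "(\<Sum>e\<in>E. B u e * B u (d e)) = B u (\<Sum>e\<in>E. B e u *\<^sub>R d e)"
    proof -
      have "B u (\<Sum>e\<in>E. B e u *\<^sub>R d e) = (\<Sum>e\<in>E. B e u * B u (d e))"
        using eU u(1) by (simp add: M.B_sum_right M.B_scale_right M.U_closed)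
      also have "\<dots> = (\<Sum>e\<in>E. B u e * B u (d e))"
        using eU(1) u(1) by (intro sum.cong refl) (metis M.B_commute)
      finally show ?thesis by simp
    qed
    finally have "tr T \<noteq> 0" using Ed u v(2) by (simp add: M.dual_bases_def)
    moreover have "linear_on_subspace U T"
      using u(1) by (simp add: linear_on_subspace_def T_def M.B_add_right M.B_scale_right scaleR_left_distrib)
    moreover have "T ` U \<subseteq> U'" using v(1) by (auto simp: T_def M'.U_closed)
    ultimately show ?case by auto
  next
    case (insert m I)
    from insert.IH[OF insert.prems(1)[OF insertI2 insertI2] insert.prems(2)[OF insertI2]]
    obtain T \<epsilon> where T: "linear_on_subspace U T" "T ` U \<subseteq> U'" "tr T \<noteq> 0"
      and \<epsilon>0: "\<forall>i\<in>I. \<bar>\<epsilon> i\<bar> = (1::real) \<and> (\<forall>x\<in>U. J' (z i) (T x) = \<epsilon> i *\<^sub>R T (J (z i) x))"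
      by auto
    have \<epsilon>: "\<And>i. i \<in> I \<Longrightarrow> \<bar>\<epsilon> i\<bar> = 1"
        "\<And>i x. i \<in> I \<Longrightarrow> x \<in> U \<Longrightarrow> J' (z i) (T x) = \<epsilon> i *\<^sub>R T (J (z i) x)"
      using \<epsilon>0 by simp_all
    have TU: "T x \<in> U'" if "x \<in> U" for x using T(2) that by blast
    define q where "q = rs_form r s (z m) (z m)"
    have "\<bar>q\<bar> = 1" using insert.prems(2) by (simp add: q_def)
    then have qq: "q * q = 1" by (metis abs_mult_self_eq mult_1)
    define \<Phi> where "\<Phi> x = J' (z m) (T (J (z m) x))" for x
    have \<Phi>U: "\<Phi> x \<in> U'" if "x \<in> U" for x
      unfolding \<Phi>_def using that by (simp add: M.J_in M'.J_in TU)
    have \<Phi>: "linear_on_subspace U \<Phi>"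
      unfolding \<Phi>_def
      using linear_on_subspace_compose[OF linear_on_subspace_compose[OF M.J_linear T(1)] M'.J_linear]
        M.J_in TU by blast
    \<comment> \<open>Moving one \<open>J'\<close> across \<open>B'\<close> gives a factor
      \<open>q\<close>, the behaviour of traces under \<open>J\<close> gives another, and
      \<open>q * q = 1\<close>.\<close>
    have "tr \<Phi> = (\<Sum>e\<in>E. q * B' (T (J (z m) e)) (T (J (z m) (d e))))"
      unfolding tr_def \<Phi>_def
    proof (intro sum.cong refl)
      fix e assume "e \<in> E"
      then show "B' (J' (z m) (T (J (z m) e))) (J' (z m) (T (J (z m) (d e)))) =
          q * B' (T (J (z m) e)) (T (J (z m) (d e)))"
        using eU[of e] by (simp add: M'.J_skew M'.J_J M.J_in M'.J_in TU M'.B_minus_right M'.B_scale_right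
            M'.U_closed q_def)
    qed
    also have "\<dots> = q * (q * (\<Sum>e\<in>E. B' (T e) (T (d e))))"
      unfolding sum_distrib_left[symmetric] q_def
    proof (subst M.trace_J[OF Ed, where F = "\<lambda>x y. B' (T x) (T y)"])
      fix y assume "y \<in> U"
      then show "linear_on_subspace U (\<lambda>x. B' (T x) (T y))" "linear_on_subspace U (\<lambda>x. B' (T y) (T x))"
        using T(1) TU unfolding linear_on_subspace_def
        by (simp_all add: M'.B_add_left M'.B_add_right M'.B_scale_left M'.B_scale_right)
    qed simp_all
    finally have tr\<Phi>: "tr \<Phi> = tr T" using qq by (simp add: tr_def mult.assoc[symmetric])
    define T' where "T' \<sigma> x = T x + \<sigma> *\<^sub>R \<Phi> x" for \<sigma> x
    have "tr (T' 1) + tr (T' (- 1)) = 2 * tr T + 2 * tr \<Phi>"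
      unfolding tr_def sum.distrib[symmetric] sum_distrib_left T'_def
      using eU by (intro sum.cong)
        (simp_all add: TU \<Phi>U M'.B_add_left M'.B_add_right M'.B_minus_left M'.B_minus_right
          M'.B_diff_left M'.B_diff_right M'.U_closed)
    then have "tr (T' 1) \<noteq> 0 \<or> tr (T' (- 1)) \<noteq> 0" using T(3) tr\<Phi> by auto
    then obtain \<sigma> :: real where \<sigma>: "\<bar>\<sigma>\<bar> = 1" "tr (T' \<sigma>) \<noteq> 0"
      by (metis abs_minus_cancel abs_one)
    have \<sigma>\<sigma>: "\<sigma> * \<sigma> = 1" using \<sigma>(1) by (metis abs_mult_self_eq mult_1)
    \<comment> \<open>At \<open>z m\<close> one has \<open>J' \<Phi> = - q T J\<close> and
      \<open>\<Phi> J = - q J' T\<close>, so \<open>T' \<sigma>\<close> commutes up to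
      \<open>- (\<sigma> * q)\<close>.\<close>
    define \<epsilon>' where "\<epsilon>' = \<epsilon>(m := - (\<sigma> * q))"
    have "linear_on_subspace U (T' \<sigma>)"
      using T(1) \<Phi> by (simp add: linear_on_subspace_def T'_def algebra_simps)
    moreover have "T' \<sigma> ` U \<subseteq> U'"
      by (auto simp: T'_def TU \<Phi>U M'.U_closed)
    moreover have "\<bar>\<epsilon>' i\<bar> = 1" if "i \<in> insert m I" for i
      using that \<epsilon>(1) \<sigma>(1) \<open>\<bar>q\<bar> = 1\<close> by (auto simp: \<epsilon>'_def abs_mult)
    moreover have "J' (z i) (T' \<sigma> x) = \<epsilon>' i *\<^sub>R T' \<sigma> (J (z i) x)" if i: "i \<in> insert m I" and x: "x \<in> U" for i x
    proof (cases "i = m")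
      case True
      have 1: "J' (z m) (T' \<sigma> x) = J' (z m) (T x) - (\<sigma> * q) *\<^sub>R T (J (z m) x)"
        using x by (simp add: T'_def \<Phi>_def M'.J_add M'.J_scale M'.J_J TU M.J_in M'.J_in M'.U_closed q_def)
      have "\<Phi> (J (z m) x) = - q *\<^sub>R J' (z m) (T x)"
        using x by (simp add: \<Phi>_def M.J_J linear_on_subspace_scale[OF T(1)] linear_on_subspace_neg[OF T(1)]
            M'.J_scale M'.J_minus TU M.U_closed M'.U_closed q_def)
      then have 2: "T' \<sigma> (J (z m) x) = T (J (z m) x) - (\<sigma> * q) *\<^sub>R J' (z m) (T x)"
        by (simp add: T'_def)
      have "(\<sigma> * q) * (\<sigma> * q) = (\<sigma> * \<sigma>) * (q * q)" by (simp only: mult.assoc mult.left_commute)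
      then have "(\<sigma> * q) * (\<sigma> * q) = 1" using qq \<sigma>\<sigma> by simp
      then show ?thesis unfolding True 1 2 \<epsilon>'_def by (simp add: scaleR_diff_right)
    next
      case False
      then have iI: "i \<in> I" using i by simp
      have orth: "rs_form r s (z i) (z m) = 0" using insert.prems(1)[of i m] i False by simp
      \<comment> \<open>\<open>\<Phi>\<close> keeps the earlier signs of \<open>T\<close>:
        anticommuting once on the \<open>J'\<close> side and once on the \<open>J\<close> side
        produces two minus signs that cancel.\<close>
      have "J' (z i) (\<Phi> x) = - J' (z m) (J' (z i) (T (J (z m) x)))"
        unfolding \<Phi>_def by (rule M'.J_anticommute[OF orth]) (simp add: x TU M.J_in)
      also have "\<dots> = - J' (z m) (\<epsilon> i *\<^sub>R T (J (z i) (J (z m) x)))"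
        using \<epsilon>(2)[OF iI M.J_in[OF x]] by simp
      also have "\<dots> = \<epsilon> i *\<^sub>R \<Phi> (J (z i) x)"
        using x by (simp add: M.J_anticommute[OF orth x] linear_on_subspace_neg[OF T(1)] M.J_in M'.J_in
            M'.J_scale M'.J_minus TU M'.U_closed \<Phi>_def)
      finally show ?thesis
        using x False \<epsilon>(2)[OF iI x]
        by (simp add: T'_def \<epsilon>'_def M'.J_add M'.J_scale TU \<Phi>U M'.U_closed scaleR_add_right scaleR_left_commute)
    qed
    ultimately show ?case using \<sigma>(2) by blast
  qed
  then obtain T \<epsilon> where T: "linear_on_subspace U T" "T ` U \<subseteq> U'"
    "\<forall>i\<in>I. \<bar>\<epsilon> i\<bar> = (1::real) \<and> (\<forall>x\<in>U. J' (z i) (T x) = \<epsilon> i *\<^sub>R T (J (z i) x))" "tr T \<noteq> 0"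
    by blast
  have "\<exists>e\<in>E. B' (T e) (T (d e)) \<noteq> 0"
  proof (rule ccontr)
    assume "\<not> ?thesis"
    then have "tr T = 0" by (simp add: tr_def)
    then show False using T(4) by simp
  qed
  then obtain e where e: "e \<in> E" "B' (T e) (T (d e)) \<noteq> 0" by auto
  then have "\<exists>x\<in>U. \<exists>y\<in>U. B' (T x) (T y) \<noteq> 0"
    by (intro bexI[of _ e] bexI[of _ "d e"]) (simp_all add: eU)
  with T(1-3) show ?thesis by (intro exI[of _ T] exI[of _ \<epsilon>]) simp
qed

text \<open>\<open>T\<close> passes through the factors one at a time and collects the product of
  the signs. A general list of indices makes the induction possible.\<close>

lemma volume_form_intertwine:
  assumes "admissible r s U J B" "admissible r s U' J' B'"
    and "T ` U \<subseteq> U'" "x \<in> U" "set L \<subseteq> I"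
    and "\<And>i x. i \<in> I \<Longrightarrow> x \<in> U \<Longrightarrow> J' (z i) (T x) = \<epsilon> i *\<^sub>R T (J (z i) x)"
  shows "foldr (\<lambda>j f. J' (z j) \<circ> f) L id (T x)
    = prod_list (map \<epsilon> L) *\<^sub>R T (foldr (\<lambda>j f. J (z j) \<circ> f) L id x)"
proof -
  interpret M: admissible r s U J B by (rule assms(1))
  interpret M': admissible r s U' J' B' by (rule assms(2))
  show ?thesis
    using assms(5)
  proof (induction L)
    case (Cons i L)
    let ?y = "foldr (\<lambda>j f. J (z j) \<circ> f) L id x"
    have y: "?y \<in> U" using M.volume_form_in[OF assms(4), of z L] .
    then have "T ?y \<in> U'" using assms(3) by blast
    have IH: "foldr (\<lambda>j f. J' (z j) \<circ> f) L id (T x) = prod_list (map \<epsilon> L) *\<^sub>R T ?y"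
      using Cons.prems by (intro Cons.IH) simp
    have "foldr (\<lambda>j f. J' (z j) \<circ> f) (i # L) id (T x) = J' (z i) (foldr (\<lambda>j f. J' (z j) \<circ> f) L id (T x))"
      by simp
    also have "\<dots> = prod_list (map \<epsilon> L) *\<^sub>R \<epsilon> i *\<^sub>R T (J (z i) ?y)"
      unfolding IH using assms(6)[OF _ y] Cons.prems \<open>T ?y \<in> U'\<close> by (simp only: M'.J_scale) simp
    also have "\<dots> = prod_list (map \<epsilon> (i # L)) *\<^sub>R T (foldr (\<lambda>j f. J (z j) \<circ> f) (i # L) id x)"
      by simp
    finally show ?case .
  qed simp
qed

text \<open>A signed intertwiner is corrected by precomposing it with the product \<open>W\<close>
  of the \<open>J (z i)\<close> of sign -1. This removes every sign because their number is even;
  linearity in \<open>w\<close> extends the relation from the basis.\<close>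

lemma intertwiner_exists:
  fixes J :: "real ^ 'n::{finite,linorder} \<Rightarrow> 'u::real_vector \<Rightarrow> 'u"
    and J' :: "real ^ 'n::{finite,linorder} \<Rightarrow> 'v::real_vector \<Rightarrow> 'v"
    and z :: "nat \<Rightarrow> real ^ 'n::{finite,linorder}"
  assumes "admissible r s U J B" "admissible r s U' J' B'" "U \<noteq> {0}" "U' \<noteq> {0}"
    and z: "rs_orthonormal_basis r s z"
    and vol: "\<And>x. x \<in> U \<Longrightarrow> volume_form (r + s) z J x = x"
      "\<And>x. x \<in> U' \<Longrightarrow> volume_form (r + s) z J' x = x"
  shows "\<exists>T. linear_on_subspace U T \<and> T ` U \<subseteq> U' \<and>
    (\<forall>w. \<forall>x\<in>U. J' w (T x) = T (J w x)) \<and> (\<exists>x\<in>U. \<exists>y\<in>U. B' (T x) (T y) \<noteq> 0)"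
proof -
  interpret M: admissible r s U J B by fact
  interpret M': admissible r s U' J' B' by fact
  define I where "I = {1..r + s}"
  have orth: "rs_form r s (z i) (z j) = 0" if "i \<in> I" "j \<in> I" "i \<noteq> j" for i j
    using z that unfolding rs_orthonormal_basis_def I_def by blast
  have unit: "\<bar>rs_form r s (z i) (z i)\<bar> = 1" if "i \<in> I" for i
    using z that unfolding rs_orthonormal_basis_def I_def by blast
  have "finite I" by (simp add: I_def)
  from signed_intertwiner[OF assms(1-4) this, of z, OF orth unit]
  obtain T \<epsilon> where T: "linear_on_subspace U T" "T ` U \<subseteq> U'"
    and \<epsilon>0: "\<forall>i\<in>I. \<bar>\<epsilon> i\<bar> = (1::real) \<and> (\<forall>x\<in>U. J' (z i) (T x) = \<epsilon> i *\<^sub>R T (J (z i) x))"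
    and "\<exists>x\<in>U. \<exists>y\<in>U. B' (T x) (T y) \<noteq> 0"
    by auto
  then obtain x0 y0 where xy: "x0 \<in> U" "y0 \<in> U" "B' (T x0) (T y0) \<noteq> 0" by auto
  have \<epsilon>: "\<And>i. i \<in> I \<Longrightarrow> \<bar>\<epsilon> i\<bar> = 1"
      "\<And>i x. i \<in> I \<Longrightarrow> x \<in> U \<Longrightarrow> J' (z i) (T x) = \<epsilon> i *\<^sub>R T (J (z i) x)"
    using \<epsilon>0 by simp_all
  have TU: "T x \<in> U'" if "x \<in> U" for x using T(2) that by blast
  define M where "M = {i\<in>I. \<epsilon> i = - 1}"
  have "even (card M)"
  proof -
    \<comment> \<open>Both volume forms act as the identity, so the product of the signs fixes the
      vector \<open>T x0\<close>; as this is nonzero, the product is 1.\<close>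
    have "T x0 \<noteq> 0" using M'.B_scale_left[of 0 "T y0" 0] TU xy M'.U_closed(1) by auto
    moreover have "T x0 = prod_list (map \<epsilon> [1..<Suc (r + s)]) *\<^sub>R T x0"
      using volume_form_intertwine[OF assms(1,2) T(2) xy(1), of "[1..<Suc (r + s)]" I z \<epsilon>] \<epsilon>(2)
        vol(1)[OF xy(1)] vol(2)[OF TU[OF xy(1)]]
      unfolding volume_form_def I_def by fastforce
    ultimately have "prod_list (map \<epsilon> [1..<Suc (r + s)]) = 1"
      by (metis scaleR_cancel_right scaleR_one)
    then have "prod \<epsilon> (set [1..<Suc (r + s)]) = 1"
      by (subst prod.distinct_set_conv_list) simp_all
    moreover have "set [1..<Suc (r + s)] = I" by (auto simp: I_def)
    ultimately have "prod \<epsilon> I = 1" by simp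
    moreover have "prod \<epsilon> I = (\<Prod>i\<in>I. if i \<in> M then - 1 else 1)"
    proof (intro prod.cong refl)
      fix i assume "i \<in> I"
      then show "\<epsilon> i = (if i \<in> M then - 1 else 1)" using \<epsilon>(1)[of i] by (auto simp: M_def abs_if split: if_splits)
    qed
    moreover have "\<dots> = (- 1) ^ card M"
    proof -
      have "I \<inter> {i. i \<in> M} = M" by (auto simp: M_def)
      then show ?thesis using \<open>finite I\<close> by (simp add: prod.If_cases)
    qed
    ultimately show ?thesis by (metis neg_one_odd_power one_neq_neg_one)
  qed
  have "finite M" "M \<subseteq> I" using \<open>finite I\<close> by (auto simp: M_def)
  from M.subset_product[OF this, of z, OF orth unit]
  obtain W where W01: "linear_on_subspace U W" "W ` U = U"
    and W0: "\<forall>i\<in>I. \<forall>x\<in>U. J (z i) (W x) = (- 1) ^ card (M - {i}) *\<^sub>R W (J (z i) x)"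
    by auto
  have W: "linear_on_subspace U W" "W ` U = U"
    "\<And>i x. i \<in> I \<Longrightarrow> x \<in> U \<Longrightarrow> J (z i) (W x) = (- 1) ^ card (M - {i}) *\<^sub>R W (J (z i) x)"
    using W01 W0 by simp_all
  have WU: "W x \<in> U" if "x \<in> U" for x using W(2) that by blast
  define P where "P x = T (W x)" for x
  have P: "linear_on_subspace U P"
    unfolding P_def using linear_on_subspace_compose[OF W(1) T(1)] WU by blast
  have PU: "P x \<in> U'" if "x \<in> U" for x using that by (simp add: P_def TU WU)
  have basis: "J' (z i) (P x) = P (J (z i) x)" if i: "i \<in> I" and x: "x \<in> U" for i x
  proof -
    \<comment> \<open>Removing \<open>i\<close> from the even set \<open>M\<close> leaves an odd set
      if \<open>i\<close> lies in \<open>M\<close> and an even one otherwise, so the sign of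
      \<open>W\<close> at \<open>i\<close> equals \<open>\<epsilon> i\<close>.\<close>
    have sign: "\<epsilon> i * (- 1) ^ card (M - {i}) = 1"
    proof (cases "i \<in> M")
      case True
      then have "odd (card (M - {i}))"
        using \<open>even (card M)\<close> \<open>finite M\<close> by (metis card_Suc_Diff1 even_Suc)
      then show ?thesis using True by (simp add: M_def)
    next
      case False
      then have "\<epsilon> i = 1" using \<epsilon>(1)[OF i] i by (auto simp: M_def abs_if split: if_splits)
      then show ?thesis using False \<open>even (card M)\<close> by simp
    qed
    have "J' (z i) (P x) = (\<epsilon> i * (- 1) ^ card (M - {i})) *\<^sub>R P (J (z i) x)"
      using x by (simp add: P_def \<epsilon>(2)[OF i] W(3)[OF i] WU M.J_in linear_on_subspace_scale[OF T(1)])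
    then show ?thesis by (simp only: sign scaleR_one)
  qed
  have "J' w (P x) = P (J w x)" if x: "x \<in> U" for w x
  proof -
    have "w \<in> span (z ` I)" using z by (simp add: rs_orthonormal_basis_def I_def)
    then show ?thesis
    proof (induction w rule: span_induct_alt)
      case base
      then show ?case
        using linear_0[OF M.J_linear_vec[OF x]] linear_0[OF M'.J_linear_vec[OF PU[OF x]]]
          linear_on_subspace_zero[OF P M.sub] by simp
    next
      case (step c v w)
      then obtain i where "i \<in> I" "v = z i" by blast
      then show ?case
        using step.IH basis[of i x] x
        by (simp add: linear_add[OF M.J_linear_vec[OF x]] linear_add[OF M'.J_linear_vec[OF PU[OF x]]]
            linear_scale[OF M.J_linear_vec[OF x]] linear_scale[OF M'.J_linear_vec[OF PU[OF x]]]
            linear_on_subspace_add[OF P] linear_on_subspace_scale[OF P] M.J_in M.U_closed)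
    qed
  qed
  \<comment> \<open>\<open>W\<close> maps onto \<open>U\<close>, so the pair on which the
    pulled-back form does not vanish is still reached.\<close>
  moreover have "x0 \<in> W ` U" "y0 \<in> W ` U" using xy(1,2) W(2) by simp_all
  then obtain a b where "a \<in> U" "x0 = W a" "b \<in> U" "y0 = W b" by auto
  then have "B' (P a) (P b) \<noteq> 0" using xy(3) by (simp add: P_def)
  then have "\<exists>x\<in>U. \<exists>y\<in>U. B' (P x) (P y) \<noteq> 0" using \<open>a \<in> U\<close> \<open>b \<in> U\<close> by blast
  moreover have "P ` U \<subseteq> U'" using PU by blast
  ultimately show ?thesis using P by (intro exI[of _ P]) simp
qed

section \<open>Minimal admissible modules\<close>

context admissible
begin

text \<open>Linearity is global so that \<open>poly_map\<close> can be used for polynomials in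
  \<open>S\<close>; compatibility with \<open>J\<close> and \<open>B\<close> is asked on
  \<open>U\<close>.\<close>

definition self_adjoint_endo :: "('u \<Rightarrow> 'u) \<Rightarrow> bool" where
  "self_adjoint_endo S \<longleftrightarrow> linear S \<and> S ` U \<subseteq> U \<and>
     (\<forall>z. \<forall>x\<in>U. S (J z x) = J z (S x)) \<and> (\<forall>x\<in>U. \<forall>y\<in>U. B (S x) y = B x (S y))"

lemma self_adjoint_endo_lincomb:
  assumes "self_adjoint_endo S" "self_adjoint_endo T"
  shows "self_adjoint_endo (\<lambda>x. a *\<^sub>R S x + b *\<^sub>R T x)"
proof -
  have "linear (\<lambda>x. a *\<^sub>R S x + b *\<^sub>R T x)"
    using assms by (intro linear_compose_add linear_compose_scale_right) (simp_all add: self_adjoint_endo_def)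
  moreover have ST: "S x \<in> U" "T x \<in> U" if "x \<in> U" for x
    using assms that by (auto simp: self_adjoint_endo_def)
  ultimately show ?thesis
    using assms by (auto simp: self_adjoint_endo_def U_closed J_add J_scale
        B_add_left B_add_right B_scale_left B_scale_right)
qed

lemma self_adjoint_endo_id: "self_adjoint_endo (\<lambda>x. x)"
  by (auto simp: self_adjoint_endo_def linear_ident)

lemma self_adjoint_endo_square:
  assumes "self_adjoint_endo S"
  shows "self_adjoint_endo (\<lambda>x. S (S x))"
proof -
  have "linear (\<lambda>x. S (S x))"
    using assms linear_compose[of S S] by (simp add: self_adjoint_endo_def comp_def)
  moreover have "S x \<in> U" if "x \<in> U" for x
    using assms that by (auto simp: self_adjoint_endo_def)
  ultimately show ?thesis
    using assms by (auto simp: self_adjoint_endo_def)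
qed

text \<open>If a self-adjoint endomorphism has a kernel, its image is an admissible module of smaller
  dimension.\<close>

lemma self_adjoint_endo_zero_or_inj:
  assumes "minimal_admissible_module r s U J B" "self_adjoint_endo S"
    and "y \<in> U" "y \<noteq> 0" "S y = 0" "x \<in> U"
  shows "S x = 0"
proof (rule ccontr)
  assume "S x \<noteq> 0"
  then have ne: "S ` U \<noteq> {0}" using assms(6) by blast
  have S: "linear S" "S ` U \<subseteq> U" using assms(2) by (simp_all add: self_adjoint_endo_def)
  obtain B' where "admissible_module r s (S ` U) J B'"
    using admissible_image[of S] assms(2) by (auto simp: self_adjoint_endo_def)
  then have "dim U \<le> dim (S ` U)"
    using assms(1) ne unfolding minimal_admissible_module_def by blast
  then have "inj_on S U" using linear_dim_image_inj[OF S(1) finite_dim] by blast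
  then show False
    using assms(3-5) linear_0[OF S(1)] U_closed(1) by (metis inj_onD)
qed

text \<open>A polynomial in \<open>S\<close>, linear or irreducible quadratic, annihilates some
  nonzero vector. It is itself a self-adjoint endomorphism, so by minimality it vanishes on all of
  \<open>U\<close>.\<close>

lemma self_adjoint_endo_field:
  assumes min: "minimal_admissible_module r s U J B" and S: "self_adjoint_endo S"
  shows "(\<exists>a. \<forall>x\<in>U. S x = a *\<^sub>R x) \<or>
    (\<exists>a b. b \<noteq> 0 \<and> (\<forall>x\<in>U. S (S x) = (2 * a) *\<^sub>R S x - (a\<^sup>2 + b\<^sup>2) *\<^sub>R x))"
proof -
  have lin: "linear S" "S ` U \<subseteq> U" using S by (simp_all add: self_adjoint_endo_def)
  have "U \<noteq> {0}" using min by (simp add: minimal_admissible_module_def)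
  then obtain x where x: "x \<in> U" "x \<noteq> 0" using U_closed(1) by blast
  obtain p where p: "p \<noteq> 0" "poly_map S p x = 0"
    using poly_map_annihilates[OF lin(1) finite_dim lin(2) x(1)] by blast
  obtain y where y: "y \<in> U" "y \<noteq> 0" and
    "(\<exists>a. S y = a *\<^sub>R y) \<or> (\<exists>a b. b \<noteq> 0 \<and> S (S y) = (2 * a) *\<^sub>R S y - (a\<^sup>2 + b\<^sup>2) *\<^sub>R y)"
    using real_quadratic_factor_kernel[OF lin(1) sub lin(2) p x(2,1)] by blast
  then consider a where "S y = a *\<^sub>R y"
    | a b where "b \<noteq> 0" "S (S y) = (2 * a) *\<^sub>R S y - (a\<^sup>2 + b\<^sup>2) *\<^sub>R y" by blast
  then show ?thesis
  proof cases
    case 1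
    have "self_adjoint_endo (\<lambda>x. 1 *\<^sub>R S x + (- a) *\<^sub>R x)"
      by (rule self_adjoint_endo_lincomb[OF S self_adjoint_endo_id])
    from self_adjoint_endo_zero_or_inj[OF min this y] 1
    have "\<forall>x\<in>U. S x = a *\<^sub>R x" by simp
    then show ?thesis by blast
  next
    case 2
    have "self_adjoint_endo (\<lambda>x. 1 *\<^sub>R S (S x) + (- 1) *\<^sub>R ((2 * a) *\<^sub>R S x + (- (a\<^sup>2 + b\<^sup>2)) *\<^sub>R x))"
      by (rule self_adjoint_endo_lincomb[OF self_adjoint_endo_square[OF S]
            self_adjoint_endo_lincomb[OF S self_adjoint_endo_id]])
    from self_adjoint_endo_zero_or_inj[OF min this y] 2
    have "\<forall>x\<in>U. S (S x) = (2 * a) *\<^sub>R S x - (a\<^sup>2 + b\<^sup>2) *\<^sub>R x"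
      by (simp add: algebra_simps)
    then show ?thesis using 2(1) by blast
  qed
qed

end

section \<open>Normalising an intertwiner to a similarity\<close>

text \<open>The Gram operator \<open>S = T\<^sup>* T\<close> generates a field \<open>\<real>\<close> or \<open>\<complex>\<close>. In the second case
  \<open>T\<close> is composed with \<open>\<rho> + 2 a - S\<close>, a real multiple of a square root of \<open>S\<inverse>\<close>.\<close>

lemma similarity_exists:
  fixes J :: "real ^ 'n::{finite,linorder} \<Rightarrow> 'u::real_vector \<Rightarrow> 'u"
    and J' :: "real ^ 'n::{finite,linorder} \<Rightarrow> 'v::real_vector \<Rightarrow> 'v"
  assumes "admissible r s U J B" "admissible r s U' J' B'"
    and min: "minimal_admissible_module r s U J B"
    and T: "linear_on_subspace U T" "T ` U \<subseteq> U'" "\<And>w x. x \<in> U \<Longrightarrow> J' w (T x) = T (J w x)"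
    and ne: "\<exists>x\<in>U. \<exists>y\<in>U. B' (T x) (T y) \<noteq> 0"
  shows "\<exists>P c. linear_on_subspace U P \<and> P ` U \<subseteq> U' \<and> (\<forall>w. \<forall>x\<in>U. J' w (P x) = P (J w x)) \<and>
    c \<noteq> 0 \<and> (\<forall>x\<in>U. \<forall>y\<in>U. B' (P x) (P y) = c * B x y)"
proof -
  interpret M: admissible r s U J B by fact
  interpret M': admissible r s U' J' B' by fact
  have TU: "T x \<in> U'" if "x \<in> U" for x using T(2) that by blast
  \<comment> \<open>The vector \<open>S0 x\<close> represents this functional, which makes
    \<open>S0\<close> the operator \<open>T\<^sup>* T\<close> with respect to the two forms.\<close>
  have "linear_on_subspace U (\<lambda>y. B' (T x) (T y))" if "x \<in> U" for x
    using linear_on_subspace_compose[OF T(1) M'.B_linear[OF TU[OF that]]] TU by blast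
  then have "\<forall>x\<in>U. \<exists>u. u \<in> U \<and> (\<forall>y\<in>U. B u y = B' (T x) (T y))"
    using M.riesz by blast
  then obtain S0 where S0: "\<And>x. x \<in> U \<Longrightarrow> S0 x \<in> U"
    "\<And>x y. x \<in> U \<Longrightarrow> y \<in> U \<Longrightarrow> B (S0 x) y = B' (T x) (T y)"
    by metis
  have "linear_on_subspace U S0"
    unfolding linear_on_subspace_def
  proof (intro conjI ballI allI)
    fix x y assume xy: "x \<in> U" "y \<in> U"
    show "S0 (x + y) = S0 x + S0 y"
    proof (rule M.B_eqI)
      fix w assume "w \<in> U"
      then show "B (S0 (x + y)) w = B (S0 x + S0 y) w"
        using xy by (simp add: S0 M.U_closed M.B_add_left M'.B_add_left linear_on_subspace_add[OF T(1)] TU)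
    qed (use xy in \<open>simp_all add: S0 M.U_closed\<close>)
  next
    fix c x assume x: "x \<in> U"
    show "S0 (c *\<^sub>R x) = c *\<^sub>R S0 x"
    proof (rule M.B_eqI)
      fix w assume "w \<in> U"
      then show "B (S0 (c *\<^sub>R x)) w = B (c *\<^sub>R S0 x) w"
        using x by (simp add: S0 M.U_closed M.B_scale_left M'.B_scale_left linear_on_subspace_scale[OF T(1)] TU)
    qed (use x in \<open>simp_all add: S0 M.U_closed\<close>)
  qed
  then obtain S where S: "linear S" "\<And>x. x \<in> U \<Longrightarrow> S x = S0 x"
    using linear_on_subspace_extend M.finite_dim by blast
  have SU: "S x \<in> U" if "x \<in> U" for x using that by (simp add: S S0)
  have BS: "B (S x) y = B' (T x) (T y)" if "x \<in> U" "y \<in> U" for x y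
    using that by (simp add: S S0)
  have "S (J z x) = J z (S x)" if x: "x \<in> U" for z x
  proof (rule M.B_eqI)
    fix y assume y: "y \<in> U"
    have "B (S (J z x)) y = B' (J' z (T x)) (T y)" using x y by (simp add: BS M.J_in T(3))
    also have "\<dots> = - B' (T x) (T (J z y))" using x y M'.J_skew[of "T x" "T y" z] by (simp add: TU T(3))
    also have "\<dots> = B (J z (S x)) y" using x y by (simp add: M.J_skew SU BS M.J_in)
    finally show "B (S (J z x)) y = B (J z (S x)) y" .
  qed (use x in \<open>simp_all add: SU M.J_in\<close>)
  moreover have "B (S x) y = B x (S y)" if "x \<in> U" "y \<in> U" for x y
  proof -
    have "B (S x) y = B' (T y) (T x)" using that by (simp add: BS M'.B_commute[of "T x" "T y"] TU)
    also have "\<dots> = B x (S y)" using that BS[of y x] M.B_commute[of x "S y"] SU by simp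
    finally show ?thesis .
  qed
  ultimately have endo: "M.self_adjoint_endo S"
    using S(1) SU by (auto simp: M.self_adjoint_endo_def)
  obtain x0 y0 where xy0: "x0 \<in> U" "y0 \<in> U" "B (S x0) y0 \<noteq> 0" using ne BS by metis
  consider a where "\<forall>x\<in>U. S x = a *\<^sub>R x"
    | a b where "b \<noteq> 0" "\<forall>x\<in>U. S (S x) = (2 * a) *\<^sub>R S x - (a\<^sup>2 + b\<^sup>2) *\<^sub>R x"
    using M.self_adjoint_endo_field[OF min endo] by blast
  then show ?thesis
  proof cases
    case 1
    then have "a \<noteq> 0" using xy0 M.B_scale_left[of x0 y0 a] by auto
    moreover have "\<forall>x\<in>U. \<forall>y\<in>U. B' (T x) (T y) = a * B x y"
      using 1 BS[symmetric] M.B_scale_left by simp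
    ultimately show ?thesis using T by (intro exI[of _ T] exI[of _ a]) simp
  next
    case 2
    define \<rho> where "\<rho> = sqrt (a\<^sup>2 + b\<^sup>2)"
    have \<rho>2: "\<rho>\<^sup>2 = a\<^sup>2 + b\<^sup>2" by (simp add: \<rho>_def)
    \<comment> \<open>\<open>b \<noteq> 0\<close> makes this strict, so \<open>\<rho> + a\<close> is
      positive and the final factor does not vanish.\<close>
    have "\<bar>a\<bar> < \<rho>"
      unfolding \<rho>_def by (rule real_less_rsqrt) (use 2(1) in simp)
    then have pos: "\<rho> + a > 0" "\<rho> > 0" by linarith+
    \<comment> \<open>Read \<open>S\<close> as a complex number \<open>\<mu>\<close> of real part
      \<open>a\<close> and modulus \<open>\<rho>\<close>. Then \<open>2 a - S\<close> is its
      conjugate \<open>\<nu>\<close>, and the square of \<open>\<rho> + \<nu>\<close> times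
      \<open>\<mu>\<close> is \<open>\<rho>\<^sup>2 * (\<mu> + 2 * \<rho> + \<nu>)\<close>, which is
      real.\<close>
    define p where "p x = (\<rho> + 2 * a) *\<^sub>R x + (- 1) *\<^sub>R S x" for x
    have endo_p: "M.self_adjoint_endo p"
      unfolding p_def by (rule M.self_adjoint_endo_lincomb[OF M.self_adjoint_endo_id endo])
    have pU: "p x \<in> U" if "x \<in> U" for x using endo_p that by (auto simp: M.self_adjoint_endo_def)
    have p: "linear p" using endo_p by (simp add: M.self_adjoint_endo_def)
    have pSp: "p (S (p x)) = (2 * \<rho>\<^sup>2 * (\<rho> + a)) *\<^sub>R x" if x: "x \<in> U" for x
    proof -
      have SS: "S (S x) = (2 * a) *\<^sub>R S x - \<rho>\<^sup>2 *\<^sub>R x" using 2(2) x by (simp add: \<rho>2)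
      have "S (p x) = \<rho> *\<^sub>R S x + \<rho>\<^sup>2 *\<^sub>R x"
        by (simp add: p_def linear_add[OF S(1)] linear_diff[OF S(1)] linear_scale[OF S(1)] SS algebra_simps)
      then have "p (S (p x)) = (\<rho> + 2 * a) *\<^sub>R (\<rho> *\<^sub>R S x + \<rho>\<^sup>2 *\<^sub>R x) - (\<rho> *\<^sub>R S (S x) + \<rho>\<^sup>2 *\<^sub>R S x)"
        by (simp add: p_def linear_add[OF S(1)] linear_scale[OF S(1)])
      then show ?thesis unfolding SS
        by (simp add: algebra_simps power2_eq_square) (simp flip: scaleR_left_distrib)
    qed
    define P where "P x = T (p x)" for x
    have "linear_on_subspace U p"
      using p by (simp add: linear_on_subspace_def linear_add linear_scale)
    then have "linear_on_subspace U P"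
      unfolding P_def using linear_on_subspace_compose[OF _ T(1)] pU by blast
    moreover have "P ` U \<subseteq> U'" using TU pU by (auto simp: P_def)
    moreover have "\<forall>w. \<forall>x\<in>U. J' w (P x) = P (J w x)"
      using T(3) pU endo_p by (simp add: P_def M.self_adjoint_endo_def)
    moreover have "\<forall>x\<in>U. \<forall>y\<in>U. B' (P x) (P y) = (2 * \<rho>\<^sup>2 * (\<rho> + a)) * B x y"
    proof (intro ballI)
      fix x y assume xy: "x \<in> U" "y \<in> U"
      have "B' (P x) (P y) = B (S (p x)) (p y)" using xy by (simp add: P_def BS pU)
      also have "\<dots> = B (p (S (p x))) y" using xy endo_p SU pU by (simp add: M.self_adjoint_endo_def)
      also have "\<dots> = (2 * \<rho>\<^sup>2 * (\<rho> + a)) * B x y" using xy by (simp add: pSp M.B_scale_left)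
      finally show "B' (P x) (P y) = (2 * \<rho>\<^sup>2 * (\<rho> + a)) * B x y" .
    qed
    moreover have "2 * \<rho>\<^sup>2 * (\<rho> + a) \<noteq> 0" using pos by simp
    ultimately show ?thesis by (intro exI[of _ P] exI[of _ "2 * \<rho>\<^sup>2 * (\<rho> + a)"]) simp
  qed
qed

section \<open>The bracket, the sign twist and images of similarities\<close>

lemma (in admissible) module_bracket_eqI:
  assumes "CARD('n) = r + s" "\<And>z. B (J z x) y = rs_form r s z w"
  shows "module_bracket r s J B x y = w"
  unfolding module_bracket_def
proof (rule the_equality)
  show "\<forall>z. B (J z x) y = rs_form r s z w" using assms(2) by simp
  fix w' assume "\<forall>z. B (J z x) y = rs_form r s z w'"
  then show "w' = w" using assms(2) by (intro rs_form_nondegenerate[OF assms(1)]) simp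
qed

text \<open>The pairing is linear in \<open>z\<close>, so a Riesz vector exists, and by
  non-degeneracy it is the one that the definite description denotes.\<close>

lemma (in admissible) module_bracket:
  assumes "CARD('n) = r + s" "x \<in> U" "y \<in> U"
  shows "B (J z x) y = rs_form r s z (module_bracket r s J B x y)"
proof -
  have "linear (\<lambda>z. B (J z x) y)"
    using assms(2,3) linear_add[OF J_linear_vec[OF assms(2)]] linear_scale[OF J_linear_vec[OF assms(2)]]
    by (intro linearI) (simp_all add: B_add_left B_scale_left J_in)
  then obtain w where w: "\<forall>z. B (J z x) y = rs_form r s z w"
    using rs_form_riesz[OF assms(1)] by blast
  then have "module_bracket r s J B x y = w"
    using module_bracket_eqI[OF assms(1)] by simp
  then show ?thesis using w by simp
qed

text \<open>\<open>rs_form r s z z\<close> is unchanged under \<open>z \<mapsto> - z\<close>, so the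
  Clifford relation survives the twist. This serves to bring both modules to the same volume
  form.\<close>

lemma admissible_uminus:
  assumes "admissible r s U J B"
  shows "admissible r s U (\<lambda>z. J (- z)) B"
proof -
  interpret admissible r s U J B by (rule assms)
  have "linear (\<lambda>z. J (- z) x)" if "x \<in> U" for x
    using linear_compose[OF linear_uminus J_linear_vec[OF that]] by (simp add: comp_def)
  then have "clifford_module r s U (\<lambda>z. J (- z))"
    using J_in by (auto simp: clifford_module_def finite_dim J_linear J_J rs_form_minus_left rs_form_minus_right)
  then show ?thesis
    by unfold_locales (simp_all add: J_skew_sum)
qed

text \<open>With the minimality of \<open>U'\<close> this shows that \<open>P\<close> is onto. As
  \<open>c\<close> is nonzero, non-degeneracy passes from \<open>B\<close> to the image. The
  hypothesis on \<open>J'\<close> is stability of the image, because \<open>P\<close> will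
  intertwine the actions up to the sign of \<open>w\<close>.\<close>

lemma similarity_image_admissible:
  assumes "admissible r s U J B" "admissible r s U' J' B'"
    and P: "linear_on_subspace U P" "P ` U \<subseteq> U'" "\<And>w x. x \<in> U \<Longrightarrow> \<exists>y\<in>U. J' w (P x) = P y"
    and c: "c \<noteq> 0" "\<And>x y. x \<in> U \<Longrightarrow> y \<in> U \<Longrightarrow> B' (P x) (P y) = c * B x y"
  shows "admissible_module r s (P ` U) J' B'"
proof -
  interpret M: admissible r s U J B by (rule assms(1))
  interpret M': admissible r s U' J' B' by (rule assms(2))
  obtain g where g: "linear g" "\<And>x. x \<in> U \<Longrightarrow> g x = P x"
    using linear_on_subspace_extend[OF P(1) M.finite_dim] by auto
  have gP: "g ` U = P ` U" using g(2) by (rule image_cong[OF refl])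
  obtain b where "finite b" "span b = U" using M.finite_dim by (auto simp: finite_dim_subspace_def)
  then have "finite (g ` b)" "span (g ` b) = P ` U"
    using linear_span_image[OF g(1), of b] gP by simp_all
  then have "finite_dim_subspace (P ` U)" unfolding finite_dim_subspace_def by blast
  moreover have "J' w ` P ` U \<subseteq> P ` U" for w using P(3) by (auto simp: image_iff)
  moreover have PU: "x \<in> U'" if "x \<in> P ` U" for x using P(2) that by (rule subsetD)
  ultimately have "clifford_module r s (P ` U) J'"
    by (simp add: clifford_module_def linear_on_subspace_subset[OF M'.J_linear P(2)] M'.J_linear_vec M'.J_J)
  moreover have "nondegenerate_symmetric_form (P ` U) B'"
    unfolding nondegenerate_symmetric_form_def
  proof (intro conjI ballI impI)
    show "linear_on_subspace (P ` U) (B' x)" if "x \<in> P ` U" for x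
      using linear_on_subspace_subset[OF M'.B_linear P(2)] PU that by simp
    show "B' x y = B' y x" if "x \<in> P ` U" "y \<in> P ` U" for x y
      using M'.B_commute PU that by simp
    fix u assume "u \<in> P ` U" and zero: "\<forall>v\<in>P ` U. B' u v = 0"
    then obtain x where x: "x \<in> U" "u = P x" by auto
    have "B x y = 0" if "y \<in> U" for y using zero x c that by simp
    then have "x = 0" using M.B_nondegenerate[OF x(1)] by simp
    then show "u = 0" using x linear_on_subspace_zero[OF P(1) M.sub] by simp
  qed
  ultimately show ?thesis
    unfolding admissible_module_def using M'.J_skew_sum PU by simp
qed

text \<open>The identity intertwines the two actions with sign -1 at every \<open>z j\<close>, so an
  odd number of factors reverses the volume form.\<close>

lemma (in admissible) volume_form_uminus:
  assumes "odd n" "x \<in> U" "volume_form n z J x = - x"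
  shows "volume_form n z (\<lambda>z. J (- z)) x = x"
proof -
  have "foldr (\<lambda>j f. J (- z j) \<circ> f) L id x = x"
    if "odd (length L)" "foldr (\<lambda>j f. J (z j) \<circ> f) L id x = - x" for L
  proof -
    have "foldr (\<lambda>j f. J (z j) \<circ> f) L id x
      = prod_list (map (\<lambda>_. - 1) L) *\<^sub>R foldr (\<lambda>j f. J (- z j) \<circ> f) L id x"
      using volume_form_intertwine[OF admissible_uminus[OF admissible_axioms] admissible_axioms,
          where T = "\<lambda>x. x" and L = L and I = UNIV and z = z and \<epsilon> = "\<lambda>_. - 1" and x = x]
        assms(2) linear_neg[OF J_linear_vec]
      by simp
    also have "prod_list (map (\<lambda>_. - 1 :: real) L) = (- 1) ^ length L"
      by (induction L) simp_all
    also have "\<dots> = - 1" using that(1) by simp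
    finally show ?thesis using that(2) by (simp only: scaleR_minus1_left neg_equal_iff_equal)
  qed
  then show ?thesis using assms(1,3) unfolding volume_form_def by (simp del: upt_Suc)
qed

section \<open>The isomorphism of the Lie algebras\<close>

theorem theorem13:
  fixes r s :: nat
    and z :: "nat \<Rightarrow> real ^ 'n::{finite,linorder}"
    and U :: "'u::real_vector set"
    and J :: "(real, 'n) vec \<Rightarrow> 'u \<Rightarrow> 'u"
    and B :: "'u \<Rightarrow> 'u \<Rightarrow> real"
    and U' :: "'v::real_vector set"
    and J' :: "(real, 'n) vec \<Rightarrow> 'v \<Rightarrow> 'v"
    and B' :: "'v \<Rightarrow> 'v \<Rightarrow> real"
  assumes "CARD('n) = r + s"
    and "[int r - int s = 3] (mod 4)"
    and "even s"
    and "rs_orthonormal_basis r s z"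
    and "minimal_admissible_module r s U J B"
    and "\<forall>x\<in>U. volume_form (r + s) z J x = x"
    and "minimal_admissible_module r s U' J' B'"
    and "\<forall>x\<in>U'. volume_form (r + s) z J' x = - x"
  shows "lie_algebras_isomorphic
           (N_carrier U :: ('u \<times> (real, 'n) vec) set) (N_bracket r s J B)
           (N_carrier U' :: ('v \<times> (real, 'n) vec) set) (N_bracket r s J' B')"
proof -
  have adm: "admissible r s U J B" "admissible r s U' J' B'" and ne: "U \<noteq> {0}" "U' \<noteq> {0}"
    using assms(5,7) by (simp_all add: minimal_admissible_module_def admissible_iff)
  interpret M: admissible r s U J B by (rule adm(1))
  interpret M': admissible r s U' J' B' by (rule adm(2))
  \<comment> \<open>\<open>r - s\<close> and \<open>r + s\<close> have the same parity, so twisting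
    \<open>J'\<close> by \<open>- z\<close> turns its volume form into the identity.\<close>
  have "(int r - int s) mod 4 = 3" using assms(2) by (simp add: cong_def)
  then have "odd (r + s)" by presburger
  then have vol: "volume_form (r + s) z (\<lambda>z. J' (- z)) x = x" if "x \<in> U'" for x
    using M'.volume_form_uminus assms(8) that by simp
  have K: "admissible r s U' (\<lambda>z. J' (- z)) B'" by (rule admissible_uminus[OF adm(2)])
  obtain T where T: "linear_on_subspace U T" "T ` U \<subseteq> U'"
    "\<forall>w. \<forall>x\<in>U. J' (- w) (T x) = T (J w x)" "\<exists>x\<in>U. \<exists>y\<in>U. B' (T x) (T y) \<noteq> 0"
    using intertwiner_exists[OF adm(1) K ne assms(4), OF bspec[OF assms(6)] vol] by auto
  have "J' (- w) (T x) = T (J w x)" if "x \<in> U" for w x using T(3) that by simp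
  from similarity_exists[OF adm(1) K assms(5) T(1,2) this T(4)]
  obtain P c where P: "linear_on_subspace U P" "P ` U \<subseteq> U'" and c: "c \<noteq> 0"
    and P0: "\<forall>w. \<forall>x\<in>U. J' (- w) (P x) = P (J w x)" "\<forall>x\<in>U. \<forall>y\<in>U. B' (P x) (P y) = c * B x y"
    by auto
  have JP: "J' w (P x) = P (J (- w) x)" if "x \<in> U" for w x
    using P0(1)[rule_format, OF that, of "- w"] by simp
  have BP: "B' (P x) (P y) = c * B x y" if "x \<in> U" "y \<in> U" for x y
    using P0(2) that by simp
  have PU: "P x \<in> U'" if "x \<in> U" for x using P(2) that by auto
  have inj: "inj_on P U"
  proof (rule inj_onI)
    fix x y assume xy: "x \<in> U" "y \<in> U" "P x = P y"
    show "x = y"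
    proof (rule M.B_eqI[OF xy(1,2)])
      fix w assume "w \<in> U"
      then show "B x w = B y w" using BP[of x w] BP[of y w] xy c by simp
    qed
  qed
  \<comment> \<open>The image is a nonzero admissible module inside \<open>U'\<close>, so the
    minimality of \<open>U'\<close> forces equality.\<close>
  have surj: "P ` U = U'"
  proof -
    have ex: "\<exists>y\<in>U. J' w (P x) = P y" if "x \<in> U" for w x
      using JP[OF that, of w] M.J_in[OF that, of "- w"] by auto
    have im: "admissible_module r s (P ` U) J' B'"
      by (rule similarity_image_admissible[OF adm P ex c BP])
    obtain u where u: "u \<in> U" "B u u \<noteq> 0" using M.nonisotropic[OF ne(1)] .
    then have "P u \<noteq> 0"
      using BP[OF u(1) u(1)] c M'.B_scale_left[of 0 0 0] M'.U_closed(1) by auto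
    then have "P ` U \<noteq> {0}" using u(1) by auto
    then have "dim U' \<le> dim (P ` U)"
      using im assms(7) unfolding minimal_admissible_module_def by blast
    moreover have "subspace (P ` U)"
      using im by (simp add: admissible_module_def clifford_module_def finite_dim_subspace_imp_subspace)
    ultimately show ?thesis using subspace_dim_eqI P(2) M'.finite_dim by blast
  qed
  \<comment> \<open>The factor \<open>c\<close> comes from the similarity, and the minus sign from
    \<open>P\<close> intertwining \<open>J (- w)\<close> with \<open>J' w\<close>.\<close>
  have bracket: "module_bracket r s J' B' (P x) (P y) = - c *\<^sub>R module_bracket r s J B x y"
    if "x \<in> U" "y \<in> U" for x y
  proof (rule M'.module_bracket_eqI[OF assms(1)])
    fix z
    have "B' (J' z (P x)) (P y) = c * B (J (- z) x) y"
      using that by (simp add: JP BP M.J_in)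
    also have "\<dots> = rs_form r s z (- c *\<^sub>R module_bracket r s J B x y)"
      using M.module_bracket[OF assms(1) that, of "- z"]
      by (simp only: rs_form_scale_right rs_form_minus_left)
    finally show "B' (J' z (P x)) (P y) = rs_form r s z (- c *\<^sub>R module_bracket r s J B x y)" .
  qed
  \<comment> \<open>Scaling the centre by the factor of the bracket identity makes
    \<open>\<phi>\<close> a homomorphism; \<open>c \<noteq> 0\<close> keeps it invertible.\<close>
  define \<phi> where "\<phi> p = (P (fst p), - c *\<^sub>R snd p)" for p :: "'u \<times> (real, 'n) vec"
  have "bij_betw \<phi> (N_carrier U) (N_carrier U')"
    unfolding bij_betw_def
  proof
    show "inj_on \<phi> (N_carrier U)"
      using inj c by (auto simp: inj_on_def \<phi>_def N_carrier_def)
    show "\<phi> ` N_carrier U = N_carrier U'"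
    proof (intro equalityI subsetI)
      fix q :: "'v \<times> (real, 'n) vec" assume "q \<in> N_carrier U'"
      then obtain x where "x \<in> U" "fst q = P x" using surj by (auto simp: N_carrier_def)
      then have "q = \<phi> (x, (- 1 / c) *\<^sub>R snd q)" "(x, (- 1 / c) *\<^sub>R snd q) \<in> N_carrier U"
        using c by (simp_all add: \<phi>_def N_carrier_def prod_eq_iff)
      then show "q \<in> \<phi> ` N_carrier U" by (rule image_eqI)
    qed (use PU in \<open>auto simp: \<phi>_def N_carrier_def\<close>)
  qed
  moreover have "linear_on_subspace (N_carrier U) \<phi>"
    using P(1) by (auto simp: linear_on_subspace_def \<phi>_def N_carrier_def scaleR_add_right scaleR_diff_right)
  moreover have "\<phi> (N_bracket r s J B p q) = N_bracket r s J' B' (\<phi> p) (\<phi> q)"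
    if "p \<in> N_carrier U" "q \<in> N_carrier U" for p q
    using that linear_on_subspace_zero[OF P(1) M.sub] bracket[of "fst p" "fst q"]
    by (auto simp: N_bracket_def \<phi>_def N_carrier_def)
  ultimately show ?thesis unfolding lie_algebras_isomorphic_def by auto
qed

end
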